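(* Let $\lambda\in\mathbf{k}$ be fixed, let $(X,\leq)$ be a well-ordered set and let $\leq_{\rm PL_l}$ be the left path-lexicographical order on the set $\mathfrak{S}(X)$ of nonunitary bracketed words on $X$ (defined in the context). (a) The set $$S_{\rm mrbl}:=\big\{\lfloor\lfloor x\rfloor y\rfloor+\lfloor x\lfloor y\rfloor\rfloor+\lambda xy-\lfloor x\rfloor\lfloor y\rfloor\ \big|\ x,y\in\mathfrak{S}(X)\big\}$$ is a Gröbner-Shirshov basis in $\mathbf{k}\mathfrak{S}(X)$ with respect to $\leq_{\rm PL_l}$. (b) The set $$\mathrm{Irr}(S_{\rm mrbl}):=\mathfrak{S}(X)\setminus\big\{q|_{\lfloor\lfloor x\rfloor y\rfloor}\ \big|\ x,y\in\mathfrak{S}(X),\ q\in\mathfrak{S}^\star(X)\big\}$$ is (via its image in the quotient) a $\mathbf{k}$-basis of the free nonunitary modified Rota-Baxter algebra $\mathbf{k}\mathfrak{S}(X)/\mathrm{Id}(S_{\rm mrbl})$ (of weight $\lambda$) on $X$.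
   Context: $\mathbf{k}$ is a unitary commutative ring of characteristic zero; nonunitary algebras are associative, not necessarily commutative $\mathbf{k}$-algebras, not required to have a unit. A nonunitary modified Rota-Baxter algebra of weight $\lambda$ is a nonunitary algebra $A$ with a linear operator $P:A\to A$ such that $P(x)P(y)=P(P(x)y+xP(y))+\lambda xy$ for all $x,y\in A$. Nonunitary bracketed words. For a set $Y$, let $\mathrm{Sg}(Y)$ be the free semigroup on $Y$ (nonempty words). Put $\mathfrak{S}_0(X)=\mathrm{Sg}(X)$ and $\mathfrak{S}_n(X)=\mathrm{Sg}(X\sqcup\lfloor\mathfrak{S}_{n-1}(X)\rfloor)$ for $n\ge1$, where $\lfloor Y\rfloor=\{\lfloor u\rfloor\mid u\in Y\}$ is a disjoint copy of $Y$; with the natural embeddings, $\mathfrak{S}(X)=\bigcup_{n\ge0}\mathfrak{S}_n(X)$. Each $w\in\mathfrak{S}(X)$ is uniquely $w=w_1\cdots w_k$, $k\ge1$, with $w_i\in X\sqcup\lfloor\mathfrak{S}(X)\rfloor$ (prime elements); $|w|=k$ is the breadth. $\mathbf{k}\mathfrak{S}(X)$ is the free module on $\mathfrak{S}(X)$, a nonunitary algebra with the linear operator extending $w\mapsto\lfloor w\rfloor$. $\mathrm{Id}(S)$ is the operated ideal generated by $S$ (smallest ideal containing $S$ and closed under $\lfloor\ \rfloor$); quotients carry the induced operator. $\star$-bracketed words. For a symbol $\star\notin X$, $\mathfrak{S}^\star(X)$ is the set of elements of $\mathfrak{S}(X\sqcup\{\star\})$ in which $\star$ occurs exactly once; $q|_u$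 replaces $\star$ in $q$ by $u\in\mathfrak{S}(X)$, and $q|_s=\sum_ic_iq|_{u_i}$ for $s=\sum_ic_iu_i\in\mathbf{k}\mathfrak{S}(X)$. Order. $\deg(w)$ is the total number of occurrences in $w$ of letters of $X$. Let $P,\mu$ be two symbols not in $X$, and $M(X\sqcup\{P,\mu\})$ the free monoid. If $x_1,\dots,x_k$ are the occurrences of letters of $X$ in $w$ from left to right, define $\mathrm{Path}_w(x_i)\in M(X\sqcup\{P,\mu\})$ recursively: if $w=x_i\in X$, it is $x_i$; if $w=\lfloor w'\rfloor$, it is $P\,\mathrm{Path}_{w'}(x_i)$; if $w=w_1\cdots w_n$ with $n\ge2$, $w_j$ prime, and the occurrence $x_i$ lies in $w_j$, it is $\mu\,\mathrm{Path}_{w_j}(x_i)$. Put $\mathrm{Path}_{\rm l}(w)=(\mathrm{Path}_w(x_1),\dots,\mathrm{Path}_w(x_k))$. Extend the order of $X$ to $X\sqcup\{P,\mu\}$ by $x<P<\mu$ for all $x\in X$ and order $M(X\sqcup\{P,\mu\})$ by the degree lexicographical order (length first, then lexicographically from the left). Define $u\leq_{\rm PL_l}v$ iff $(\deg(u),\mathrm{Path}_{\rm l}(u))\leq(\deg(v),\mathrm{Path}_{\rm l}(v))$ lexicographically, individual paths being compared by the degree lexicographical order. Gröbner-Shirshov bases. With respect to the order, $\overline{s}$ denotes the leading (largest) monomial of $0\ne s\in\mathbf{k}\mathfrak{S}(X)$; $s$ is monic if $\overline{s}$ has coefficient $1$. Let $f,g$ be monic. If $w=\overline fu=v\overline g$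 with $u,v,w\in\mathfrak{S}(X)$ and $\max\{|\overline f|,|\overline g|\}<|w|<|\overline f|+|\overline g|$, then $fu-vg$ is an intersection composition with respect to $w$. If $w=\overline f=q|_{\overline g}$ with $q\in\mathfrak{S}^\star(X)$, then $f-q|_g$ is an including composition with respect to $w$. An element $h$ is trivial modulo $(S,w)$ if $h=\sum_ic_iq_i|_{s_i}$ with $c_i\in\mathbf{k}$, $q_i\in\mathfrak{S}^\star(X)$, $s_i\in S$ and $\overline{q_i|_{s_i}}<w$. A monic set $S$ is a Gröbner-Shirshov basis if all intersection and including compositions (with respect to $w$) of pairs in $S$ are trivial modulo $(S,w)$. *)

theory Defs
  imports "HOL-Library.Poly_Mapping" "HOL-Algebra.QuotRing" "HOL-Algebra.Module"
begin

section \<open>Bracketed words\<close>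

text \<open>
  The type \<open>'x bword\<close> is the set \<open>\<SS>(X)\<close> of nonunitary bracketed words on the type \<open>'x\<close>: the least
  solution of \<open>\<SS> = Sg(X \<squnion> \<lfloor>\<SS>\<rfloor>)\<close>, i.e. the union of the stages \<open>\<SS>\<^sub>n\<close>. A word is a nonempty
  sequence \<open>w\<^sub>1 \<cdots> w\<^sub>k\<close> of prime elements, each one a letter or a bracketed word; \<open>PCons p w\<close> is the
  word with first prime \<open>p\<close> and remaining primes those of \<open>w\<close>.
\<close>

datatype 'x bword = Prime "'x prm" | PCons "'x prm" "'x bword"
  and 'x prm = Letter 'x | Bracket "'x bword"

abbreviation letter :: "'x \<Rightarrow> 'x bword" where
  "letter x \<equiv> Prime (Letter x)"

abbreviation br :: "'x bword \<Rightarrow> 'x bword" where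
  "br w \<equiv> Prime (Bracket w)"

primrec wcat :: "'x bword \<Rightarrow> 'x bword \<Rightarrow> 'x bword"  (infixr \<open>\<cdot>\<close> 70) where
  "Prime p \<cdot> v = PCons p v"
| "PCons p u \<cdot> v = PCons p (u \<cdot> v)"

primrec primes :: "'x bword \<Rightarrow> 'x prm list" where
  "primes (Prime p) = [p]"
| "primes (PCons p w) = p # primes w"

definition breadth :: "'x bword \<Rightarrow> nat" where
  "breadth w = length (primes w)"

primrec letters :: "'x bword \<Rightarrow> 'x list" and letters_prm :: "'x prm \<Rightarrow> 'x list" where
  "letters (Prime p) = letters_prm p"
| "letters (PCons p w) = letters_prm p @ letters w"
| "letters_prm (Letter x) = [x]"
| "letters_prm (Bracket w) = letters w"

definition deg :: "'x bword \<Rightarrow> nat" where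
  "deg w = length (letters w)"

text \<open>Words on \<open>X \<squnion> {\<star>}\<close> are words on \<open>'x option\<close>, with \<open>None\<close> for \<open>\<star>\<close>.\<close>

definition star_words :: "'x option bword set" where
  "star_words = {q. count_list (letters q) None = 1}"

primrec wsubst :: "'x option bword \<Rightarrow> 'x bword \<Rightarrow> 'x bword"
  and wsubst_prm :: "'x option prm \<Rightarrow> 'x bword \<Rightarrow> 'x bword" where
  "wsubst (Prime p) u = wsubst_prm p u"
| "wsubst (PCons p w) u = wsubst_prm p u \<cdot> wsubst w u"
| "wsubst_prm (Letter a) u = (case a of None \<Rightarrow> u | Some x \<Rightarrow> letter x)"
| "wsubst_prm (Bracket w) u = br (wsubst w u)"


section \<open>The left path-lexicographical order\<close>

datatype 'x path_sym = Sym 'x | P_sym | Mu_sym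

definition path_sym_less :: "('x::linorder path_sym \<times> 'x path_sym) set" where
  "path_sym_less =
     {(Sym x, Sym y) | x y. x < y} \<union> {(Sym x, P_sym) | x. True} \<union>
     {(Sym x, Mu_sym) | x. True} \<union> {(P_sym, Mu_sym)}"

lemma size_prm_primes: "p \<in> set (primes w) \<Longrightarrow> size p < size w"
  by (induction w rule: bword.induct[where ?P2.0 = "\<lambda>_. True"]) auto

lemma size_prime_primes_PCons [termination_simp]:
  "p = q \<or> p \<in> set (primes w) \<Longrightarrow> size p < size q + size w"
  by (cases w) (use size_prm_primes in force)+

text \<open>
  \<open>paths w\<close> lists \<open>Path\<^sub>w(x\<^sub>1), \<dots>, Path\<^sub>w(x\<^sub>k)\<close> for the letter occurrences of \<open>w\<close> from left to right.
\<close>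

fun paths :: "'x bword \<Rightarrow> 'x path_sym list list" where
  "paths (Prime (Letter x)) = [[Sym x]]"
| "paths (Prime (Bracket w)) = map (Cons P_sym) (paths w)"
| "paths (PCons p w) =
     map (Cons Mu_sym) (concat (map (\<lambda>p'. paths (Prime p')) (primes (PCons p w))))"

text \<open>
  On words of equal degree the path lists have equal length, so \<^const>\<open>lex\<close> is the lexicographic
  comparison of tuples; \<^const>\<open>lenlex\<close> is the degree lexicographical order on paths. Distinct words
  can have the same paths (e.g. \<open>\<lfloor>xy\<rfloor>\<lfloor>zuv\<rfloor>\<close> and \<open>\<lfloor>xyz\<rfloor>\<lfloor>uv\<rfloor>\<close>), so \<open>pl_le\<close> is a total preorder.
\<close>

definition pl_le :: "'x::linorder bword \<Rightarrow> 'x bword \<Rightarrow> bool" where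
  "pl_le u v \<longleftrightarrow>
     (deg u, paths u) = (deg v, paths v) \<or>
     ((deg u, paths u), (deg v, paths v)) \<in> less_than <*lex*> lex (lenlex path_sym_less)"


section \<open>The operated algebra of bracketed words\<close>

text \<open>
  Operated algebras over the scalar type \<open>'k\<close> are records. The field \<^const>\<open>one\<close> is inherited from
  the library's records and carries no meaning, because the algebras are nonunitary.
\<close>

record ('k, 'a) operated_algebra = "('k, 'a) module" +
  oper :: "'a \<Rightarrow> 'a"

abbreviation monom :: "'w \<Rightarrow> 'w \<Rightarrow>\<^sub>0 'k::zero_neq_one" where
  "monom w \<equiv> Poly_Mapping.single w 1"

definition pscale :: "'k \<Rightarrow> ('w \<Rightarrow>\<^sub>0 'k) \<Rightarrow> ('w \<Rightarrow>\<^sub>0 'k::comm_ring_1)" where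
  "pscale c s = Poly_Mapping.map ((*) c) s"

definition lin_ext :: "('v \<Rightarrow> 'w) \<Rightarrow> ('v \<Rightarrow>\<^sub>0 'k) \<Rightarrow> ('w \<Rightarrow>\<^sub>0 'k::comm_ring_1)" where
  "lin_ext f s = (\<Sum>u\<in>Poly_Mapping.keys s. Poly_Mapping.single (f u) (Poly_Mapping.lookup s u))"

definition pmult ::
    "('x bword \<Rightarrow>\<^sub>0 'k) \<Rightarrow> ('x bword \<Rightarrow>\<^sub>0 'k) \<Rightarrow> ('x bword \<Rightarrow>\<^sub>0 'k::comm_ring_1)" where
  "pmult s t =
     (\<Sum>u\<in>Poly_Mapping.keys s. \<Sum>v\<in>Poly_Mapping.keys t.
        Poly_Mapping.single (u \<cdot> v) (Poly_Mapping.lookup s u * Poly_Mapping.lookup t v))"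

definition psubst :: "'x option bword \<Rightarrow> ('x bword \<Rightarrow>\<^sub>0 'k) \<Rightarrow> ('x bword \<Rightarrow>\<^sub>0 'k::comm_ring_1)" where
  "psubst q s = lin_ext (wsubst q) s"

definition word_algebra :: "('k::comm_ring_1, 'x bword \<Rightarrow>\<^sub>0 'k) operated_algebra" where
  "word_algebra =
     \<lparr>carrier = UNIV, mult = pmult, one = undefined, zero = 0, add = (+),
      smult = pscale, oper = lin_ext br\<rparr>"


section \<open>Groebner-Shirshov bases\<close>

text \<open>
  The order is a parameter \<open>leq\<close>. The leading monomial is a largest monomial; if several monomials
  are equivalent under a preorder \<open>leq\<close>, one of them is picked, and strict comparisons with other
  words do not depend on the choice.
\<close>

definition strictly :: "('w \<Rightarrow> 'w \<Rightarrow> bool) \<Rightarrow> 'w \<Rightarrow> 'w \<Rightarrow> bool" where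
  "strictly leq u v \<longleftrightarrow> leq u v \<and> \<not> leq v u"

definition lead :: "('w \<Rightarrow> 'w \<Rightarrow> bool) \<Rightarrow> ('w \<Rightarrow>\<^sub>0 'k::zero) \<Rightarrow> 'w" where
  "lead leq s = (SOME m. m \<in> Poly_Mapping.keys s \<and> (\<forall>u\<in>Poly_Mapping.keys s. leq u m))"

definition monic :: "('w \<Rightarrow> 'w \<Rightarrow> bool) \<Rightarrow> ('w \<Rightarrow>\<^sub>0 'k::zero_neq_one) \<Rightarrow> bool" where
  "monic leq s \<longleftrightarrow> s \<noteq> 0 \<and> Poly_Mapping.lookup s (lead leq s) = 1"

definition intersection_composition ::
    "('x bword \<Rightarrow> 'x bword \<Rightarrow> bool) \<Rightarrow> ('x bword \<Rightarrow>\<^sub>0 'k) \<Rightarrow> ('x bword \<Rightarrow>\<^sub>0 'k) \<Rightarrow>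
     'x bword \<Rightarrow> ('x bword \<Rightarrow>\<^sub>0 'k::comm_ring_1) \<Rightarrow> bool" where
  "intersection_composition leq f g w h \<longleftrightarrow>
     (\<exists>u v. w = lead leq f \<cdot> u \<and> w = v \<cdot> lead leq g \<and>
        max (breadth (lead leq f)) (breadth (lead leq g)) < breadth w \<and>
        breadth w < breadth (lead leq f) + breadth (lead leq g) \<and>
        h = pmult f (monom u) - pmult (monom v) g)"

definition including_composition ::
    "('x bword \<Rightarrow> 'x bword \<Rightarrow> bool) \<Rightarrow> ('x bword \<Rightarrow>\<^sub>0 'k) \<Rightarrow> ('x bword \<Rightarrow>\<^sub>0 'k) \<Rightarrow>
     'x bword \<Rightarrow> ('x bword \<Rightarrow>\<^sub>0 'k::comm_ring_1) \<Rightarrow> bool" where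
  "including_composition leq f g w h \<longleftrightarrow>
     (\<exists>q\<in>star_words. w = lead leq f \<and> w = wsubst q (lead leq g) \<and> h = f - psubst q g)"

definition trivial_mod ::
    "('x bword \<Rightarrow> 'x bword \<Rightarrow> bool) \<Rightarrow> ('x bword \<Rightarrow>\<^sub>0 'k) set \<Rightarrow> 'x bword \<Rightarrow>
     ('x bword \<Rightarrow>\<^sub>0 'k::comm_ring_1) \<Rightarrow> bool" where
  "trivial_mod leq S w h \<longleftrightarrow>
     (\<exists>(n::nat) c q s.
        (\<forall>i<n. q i \<in> star_words \<and> s i \<in> S \<and> strictly leq (lead leq (psubst (q i) (s i))) w) \<and>
        h = (\<Sum>i<n. pscale (c i) (psubst (q i) (s i))))"

definition groebner_shirshov_basis ::
    "('x bword \<Rightarrow> 'x bword \<Rightarrow> bool) \<Rightarrow> ('x bword \<Rightarrow>\<^sub>0 'k::comm_ring_1) set \<Rightarrow> bool" where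
  "groebner_shirshov_basis leq S \<longleftrightarrow>
     (\<forall>s\<in>S. monic leq s) \<and>
     (\<forall>f\<in>S. \<forall>g\<in>S. \<forall>w h.
        intersection_composition leq f g w h \<or> including_composition leq f g w h
        \<longrightarrow> trivial_mod leq S w h)"


section \<open>Nonunitary modified Rota-Baxter algebras\<close>

locale nonunitary_algebra = abelian_group A
  for A :: "('k::comm_ring_1, 'a, 'm) module_scheme" (structure) +
  assumes mult_closed: "\<lbrakk>x \<in> carrier A; y \<in> carrier A\<rbrakk> \<Longrightarrow> x \<otimes> y \<in> carrier A"
    and mult_assoc: "\<lbrakk>x \<in> carrier A; y \<in> carrier A; z \<in> carrier A\<rbrakk>
      \<Longrightarrow> (x \<otimes> y) \<otimes> z = x \<otimes> (y \<otimes> z)"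
    and mult_add_left: "\<lbrakk>x \<in> carrier A; y \<in> carrier A; z \<in> carrier A\<rbrakk>
      \<Longrightarrow> (x \<oplus> y) \<otimes> z = (x \<otimes> z) \<oplus> (y \<otimes> z)"
    and mult_add_right: "\<lbrakk>x \<in> carrier A; y \<in> carrier A; z \<in> carrier A\<rbrakk>
      \<Longrightarrow> z \<otimes> (x \<oplus> y) = (z \<otimes> x) \<oplus> (z \<otimes> y)"
    and scale_closed: "x \<in> carrier A \<Longrightarrow> c \<odot> x \<in> carrier A"
    and scale_add_left: "x \<in> carrier A \<Longrightarrow> (c + d) \<odot> x = (c \<odot> x) \<oplus> (d \<odot> x)"
    and scale_add_right: "\<lbrakk>x \<in> carrier A; y \<in> carrier A\<rbrakk>
      \<Longrightarrow> c \<odot> (x \<oplus> y) = (c \<odot> x) \<oplus> (c \<odot> y)"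
    and scale_scale: "x \<in> carrier A \<Longrightarrow> c \<odot> (d \<odot> x) = (c * d) \<odot> x"
    and scale_one: "x \<in> carrier A \<Longrightarrow> 1 \<odot> x = x"
    and scale_mult_left: "\<lbrakk>x \<in> carrier A; y \<in> carrier A\<rbrakk> \<Longrightarrow> (c \<odot> x) \<otimes> y = c \<odot> (x \<otimes> y)"
    and scale_mult_right: "\<lbrakk>x \<in> carrier A; y \<in> carrier A\<rbrakk> \<Longrightarrow> x \<otimes> (c \<odot> y) = c \<odot> (x \<otimes> y)"

locale modified_rota_baxter_algebra = nonunitary_algebra A
  for lam :: "'k::comm_ring_1" and A :: "('k, 'a) operated_algebra" (structure) +
  assumes oper_closed: "x \<in> carrier A \<Longrightarrow> oper A x \<in> carrier A"
    and oper_add: "\<lbrakk>x \<in> carrier A; y \<in> carrier A\<rbrakk>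
      \<Longrightarrow> oper A (x \<oplus> y) = oper A x \<oplus> oper A y"
    and oper_scale: "x \<in> carrier A \<Longrightarrow> oper A (c \<odot> x) = c \<odot> oper A x"
    and modified_rota_baxter: "\<lbrakk>x \<in> carrier A; y \<in> carrier A\<rbrakk>
      \<Longrightarrow> oper A x \<otimes> oper A y
          = oper A ((oper A x \<otimes> y) \<oplus> (x \<otimes> oper A y)) \<oplus> (lam \<odot> (x \<otimes> y))"

definition operated_hom ::
    "('k::comm_ring_1, 'a) operated_algebra \<Rightarrow> ('k, 'b) operated_algebra \<Rightarrow> ('a \<Rightarrow> 'b) set" where
  "operated_hom A B =
     {f \<in> carrier A \<rightarrow> carrier B.
        (\<forall>x\<in>carrier A. \<forall>y\<in>carrier A.
           f (x \<oplus>\<^bsub>A\<^esub> y) = f x \<oplus>\<^bsub>B\<^esub> f y \<and> f (x \<otimes>\<^bsub>A\<^esub> y) = f x \<otimes>\<^bsub>B\<^esub> f y) \<and>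
        (\<forall>c. \<forall>x\<in>carrier A. f (c \<odot>\<^bsub>A\<^esub> x) = c \<odot>\<^bsub>B\<^esub> f x) \<and>
        (\<forall>x\<in>carrier A. f (oper A x) = oper B (f x))}"

text \<open>
  The universal property with respect to all target algebras whose carrier lies in the type \<open>'b\<close>.
  Homomorphisms are compared on the carrier only, hence \<^const>\<open>extensional\<close>.
\<close>

definition free_modified_rota_baxter_algebra ::
    "'b itself \<Rightarrow> 'k::comm_ring_1 \<Rightarrow> ('k, 'a) operated_algebra \<Rightarrow> ('x \<Rightarrow> 'a) \<Rightarrow> bool" where
  "free_modified_rota_baxter_algebra _ lam F \<iota> \<longleftrightarrow>
     modified_rota_baxter_algebra lam F \<and> (\<forall>x. \<iota> x \<in> carrier F) \<and>
     (\<forall>(B :: ('k, 'b) operated_algebra) \<phi>.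
        modified_rota_baxter_algebra lam B \<longrightarrow> (\<forall>x. \<phi> x \<in> carrier B) \<longrightarrow>
        (\<exists>!f. f \<in> operated_hom F B \<and> f \<in> extensional (carrier F) \<and> (\<forall>x. f (\<iota> x) = \<phi> x)))"

definition operated_ideal :: "('k::comm_ring_1, 'a) operated_algebra \<Rightarrow> 'a set \<Rightarrow> bool" where
  "operated_ideal A I \<longleftrightarrow>
     I \<subseteq> carrier A \<and> \<zero>\<^bsub>A\<^esub> \<in> I \<and>
     (\<forall>x\<in>I. \<forall>y\<in>I. x \<oplus>\<^bsub>A\<^esub> y \<in> I) \<and>
     (\<forall>c. \<forall>x\<in>I. c \<odot>\<^bsub>A\<^esub> x \<in> I) \<and>
     (\<forall>a\<in>carrier A. \<forall>x\<in>I. a \<otimes>\<^bsub>A\<^esub> x \<in> I \<and> x \<otimes>\<^bsub>A\<^esub> a \<in> I) \<and>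
     (\<forall>x\<in>I. oper A x \<in> I)"

definition operated_ideal_gen :: "('k::comm_ring_1, 'a) operated_algebra \<Rightarrow> 'a set \<Rightarrow> 'a set" where
  "operated_ideal_gen A S = \<Inter>{I. operated_ideal A I \<and> S \<subseteq> I}"

text \<open>As for \<^const>\<open>FactRing\<close>, the elements are the additive cosets of the ideal.\<close>

definition quotient_algebra ::
    "('k::comm_ring_1, 'a) operated_algebra \<Rightarrow> 'a set \<Rightarrow> ('k, 'a set) operated_algebra" where
  "quotient_algebra A I =
     \<lparr>carrier = a_rcosets\<^bsub>A\<^esub> I, mult = rcoset_mult A I, one = undefined, zero = I,
      add = set_add A,
      smult = (\<lambda>c C. \<Union>a\<in>C. I +>\<^bsub>A\<^esub> (c \<odot>\<^bsub>A\<^esub> a)),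
      oper = (\<lambda>C. \<Union>a\<in>C. I +>\<^bsub>A\<^esub> oper A a)\<rparr>"

text \<open>The family \<open>(b w)\<close>, \<open>w \<in> J\<close>, is linearly independent and spans the module.\<close>

definition basis_family ::
    "('k::comm_ring_1, 'a) operated_algebra \<Rightarrow> ('w \<Rightarrow> 'a) \<Rightarrow> 'w set \<Rightarrow> bool" where
  "basis_family A b J \<longleftrightarrow>
     (\<forall>w\<in>J. b w \<in> carrier A) \<and>
     (\<forall>F c. finite F \<longrightarrow> F \<subseteq> J \<longrightarrow> (\<Oplus>\<^bsub>A\<^esub>w\<in>F. c w \<odot>\<^bsub>A\<^esub> b w) = \<zero>\<^bsub>A\<^esub>
        \<longrightarrow> (\<forall>w\<in>F. c w = 0)) \<and>
     (\<forall>a\<in>carrier A. \<exists>F c. finite F \<and> F \<subseteq> J \<and> a = (\<Oplus>\<^bsub>A\<^esub>w\<in>F. c w \<odot>\<^bsub>A\<^esub> b w))"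


section \<open>The modified Rota-Baxter relations\<close>

definition S_mrbl :: "'k \<Rightarrow> ('x bword \<Rightarrow>\<^sub>0 'k::comm_ring_1) set" where
  "S_mrbl lam =
     {monom (br (br x \<cdot> y)) + monom (br (x \<cdot> br y)) + pscale lam (monom (x \<cdot> y))
        - monom (br x \<cdot> br y) | x y. True}"

definition Irr_mrbl :: "'x bword set" where
  "Irr_mrbl = UNIV - {wsubst q (br (br x \<cdot> y)) | q x y. q \<in> star_words}"

definition mrb_ideal :: "'k \<Rightarrow> ('x bword \<Rightarrow>\<^sub>0 'k::comm_ring_1) set" where
  "mrb_ideal lam = operated_ideal_gen word_algebra (S_mrbl lam)"

definition mrb_quotient ::
    "'k::comm_ring_1 \<Rightarrow> ('k, ('x bword \<Rightarrow>\<^sub>0 'k) set) operated_algebra" where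
  "mrb_quotient lam = quotient_algebra word_algebra (mrb_ideal lam)"

definition mrb_class :: "'k \<Rightarrow> 'x bword \<Rightarrow> ('x bword \<Rightarrow>\<^sub>0 'k::comm_ring_1) set" where
  "mrb_class lam w = mrb_ideal lam +>\<^bsub>word_algebra\<^esub> monom w"

end

theory Submission
  imports Defs
begin

text \<open>
  Part (a). The order is not compatible with contexts, but in each relation the first path of
  \<open>\<lfloor>\<lfloor>x\<rfloor>y\<rfloor>\<close> is longer than the first paths of the other monomials, and this survives in every context.
  The leading monomials have breadth one, so there are only including compositions. The only one
  that does not come from a substitution inside \<open>x\<close> or \<open>y\<close> has ambiguity \<open>\<lfloor>\<lfloor>\<lfloor>u\<rfloor>v\<rfloor>y\<rfloor>\<close>. Writing \<open>f\<close> for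
  the relations, it equals
  \<open>f(u, v\<lfloor>y\<rfloor>) - f(u, v)\<lfloor>y\<rfloor> - f(u\<lfloor>v\<rfloor>, y) + f(u, \<lfloor>v\<rfloor>y) - \<lfloor>u f(v, y)\<rfloor> + \<lfloor>u\<rfloor> f(v, y)\<close>.

  Part (b). As the order is not monomial, the composition-diamond lemma is not used. The module of
  bracketed words with concatenation carries a second operator \<open>P\<close>: \<open>P(w) = \<lfloor>w\<rfloor>\<close> if \<open>w\<close> is prime or
  starts with a letter, and \<open>P(\<lfloor>x\<rfloor>z) = \<lfloor>x\<rfloor>P(z) - P(x P(z)) - \<lambda>xz\<close>. It satisfies the modified
  Rota-Baxter identity. The homomorphism of operated algebras that fixes the letters and maps
  \<open>\<lfloor> \<rfloor>\<close> to \<open>P\<close> takes values in the span of the irreducible words, is the identity there, and is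
  congruent to the identity modulo the ideal. Since it kills the relations, its kernel is the ideal.
\<close>

section \<open>Linear maps on free modules\<close>

abbreviation lookup :: "('w \<Rightarrow>\<^sub>0 'k::zero) \<Rightarrow> 'w \<Rightarrow> 'k" where
  "lookup \<equiv> Poly_Mapping.lookup"

abbreviation keys :: "('w \<Rightarrow>\<^sub>0 'k::zero) \<Rightarrow> 'w set" where
  "keys \<equiv> Poly_Mapping.keys"

lemma lookup_pscale [simp]: "lookup (pscale c s) w = c * lookup s w"
  by (cases "lookup s w = 0") (simp_all add: pscale_def Poly_Mapping.map.rep_eq)

lemma pscale_add_right: "pscale c (s + t) = pscale c s + pscale c t"
  and pscale_diff_right: "pscale c (s - t) = pscale c s - pscale c t"
  and pscale_add_left: "pscale (c + d) s = pscale c s + pscale d s"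
  and pscale_pscale [simp]: "pscale c (pscale d s) = pscale (c * d) s"
  and pscale_one [simp]: "pscale 1 s = s"
  and pscale_zero [simp]: "pscale c 0 = 0" "pscale 0 s = 0"
  and pscale_minus_one: "pscale (- 1) s = - s"
  by (rule poly_mapping_eqI; simp add: lookup_add lookup_minus algebra_simps)+

lemma pscale_single [simp]: "pscale c (Poly_Mapping.single w d) = Poly_Mapping.single w (c * d)"
  by (rule poly_mapping_eqI) (simp add: lookup_single when_def)

lemma pscale_sum_right: "pscale c (\<Sum>i\<in>A. f i) = (\<Sum>i\<in>A. pscale c (f i))"
  by (induction A rule: infinite_finite_induct) (auto simp: pscale_add_right)

lemma sum_monoms: "(\<Sum>w\<in>keys s. pscale (lookup s w) (monom w)) = s"
  by (rule poly_mapping_eqI)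
    (simp add: Poly_Mapping.lookup_sum Poly_Mapping.lookup_single when_def in_keys_iff)

text \<open>An element is the finite sum of its scaled monomials, so adding one term at a time
  reaches it. This reduces identities that are linear in an argument to words.\<close>

lemma poly_mapping_linear_induct [case_names zero add]:
  assumes "Q 0" and "\<And>s c w. Q s \<Longrightarrow> Q (s + pscale c (monom w))"
  shows "Q (s :: 'w \<Rightarrow>\<^sub>0 'k::comm_ring_1)"
proof -
  have "Q (\<Sum>w\<in>F. pscale (lookup s w) (monom w))" if "finite F" for F
    using that
  proof (induction F rule: finite_induct)
    case empty
    show ?case using assms(1) by simp
  next
    case (insert x F)
    have "Q ((\<Sum>w\<in>F. pscale (lookup s w) (monom w)) + pscale (lookup s x) (monom x))"
      by (rule assms(2)) (rule insert.IH)
    with insert.hyps show ?case by (simp add: add.commute del: pscale_single)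
  qed
  from this[of "keys s"] show ?thesis by (simp only: sum_monoms finite_keys)
qed

section \<open>Linear maps between free modules and linear extension\<close>

definition plinear :: "(('v \<Rightarrow>\<^sub>0 'k::comm_ring_1) \<Rightarrow> ('w \<Rightarrow>\<^sub>0 'k)) \<Rightarrow> bool" where
  "plinear F \<longleftrightarrow> (\<forall>s t. F (s + t) = F s + F t) \<and> (\<forall>c s. F (pscale c s) = pscale c (F s))"

lemma plinear_add: "plinear F \<Longrightarrow> F (s + t) = F s + F t"
  and plinear_pscale: "plinear F \<Longrightarrow> F (pscale c s) = pscale c (F s)"
  by (auto simp: plinear_def)

lemma plinear_zero: "plinear F \<Longrightarrow> F 0 = 0"
  using plinear_pscale[of F 0 0] by simp

lemma plinear_minus: "plinear F \<Longrightarrow> F (- s) = - F s"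
  using plinear_pscale[of F "- 1" s] by (simp add: pscale_minus_one)

lemma plinear_diff: "plinear F \<Longrightarrow> F (s - t) = F s - F t"
  using plinear_add[of F s "- t"] by (simp add: plinear_minus)

lemma plinear_sum: "plinear F \<Longrightarrow> F (\<Sum>i\<in>A. f i) = (\<Sum>i\<in>A. F (f i))"
  by (induction A rule: infinite_finite_induct) (auto simp: plinear_add plinear_zero)

lemmas plinear_simps = plinear_add plinear_pscale plinear_zero plinear_minus plinear_diff

text \<open>Agreement is asked only on the keys of \<open>s\<close>; this lets
  \<open>nf_of_irr\<close> use that \<open>nf\<close> fixes irreducible words.\<close>

lemma plinear_eqI:
  assumes "plinear F" "plinear G" "\<And>w. w \<in> keys s \<Longrightarrow> F (monom w) = G (monom w)"
  shows "F s = G s"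
proof -
  have "H s = (\<Sum>w\<in>keys s. pscale (lookup s w) (H (monom w)))" if "plinear H" for H
    using that plinear_sum[OF that, of "\<lambda>w. pscale (lookup s w) (monom w)" "keys s"]
    unfolding sum_monoms by (simp only: plinear_pscale[OF that])
  from this[OF assms(1)] this[OF assms(2)] show ?thesis
    using assms(3) by simp
qed

lemma plinear_id: "plinear (\<lambda>s. s)"
  by (simp add: plinear_def)

lemma plinear_comp: "plinear F \<Longrightarrow> plinear G \<Longrightarrow> plinear (\<lambda>s. F (G s))"
  by (simp add: plinear_def)

lemma plinear_plus: "plinear F \<Longrightarrow> plinear G \<Longrightarrow> plinear (\<lambda>s. F s + G s)"
  and plinear_subtract: "plinear F \<Longrightarrow> plinear G \<Longrightarrow> plinear (\<lambda>s. F s - G s)"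
  and plinear_scaled: "plinear F \<Longrightarrow> plinear (\<lambda>s. pscale c (F s))"
  by (simp_all add: plinear_def pscale_add_right pscale_diff_right mult.commute)

text \<open>Unlike \<open>lin_ext\<close>, which sends words to words, this extends maps whose
  values are linear combinations, such as \<open>rb_word\<close> and \<open>nf_word\<close>.\<close>

definition plin :: "('v \<Rightarrow> ('w \<Rightarrow>\<^sub>0 'k)) \<Rightarrow> ('v \<Rightarrow>\<^sub>0 'k) \<Rightarrow> ('w \<Rightarrow>\<^sub>0 'k::comm_ring_1)" where
  "plin g s = (\<Sum>u\<in>keys s. pscale (lookup s u) (g u))"

lemma plin_superset:
  assumes "finite F" "keys s \<subseteq> F"
  shows "plin g s = (\<Sum>u\<in>F. pscale (lookup s u) (g u))"
  unfolding plin_def using assms by (intro sum.mono_neutral_left) (auto simp: in_keys_iff)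

lemma plinear_plin:
  fixes g :: "'v \<Rightarrow> ('w \<Rightarrow>\<^sub>0 'k::comm_ring_1)"
  shows "plinear (plin g)"
  unfolding plinear_def
proof (intro conjI allI)
  fix s t :: "'v \<Rightarrow>\<^sub>0 'k" and c :: 'k
  let ?F = "keys s \<union> keys t \<union> keys (s + t)"
  have "plin g s = (\<Sum>u\<in>?F. pscale (lookup s u) (g u))"
    and "plin g t = (\<Sum>u\<in>?F. pscale (lookup t u) (g u))"
    and "plin g (s + t) = (\<Sum>u\<in>?F. pscale (lookup (s + t) u) (g u))"
    by (intro plin_superset; auto)+
  then show "plin g (s + t) = plin g s + plin g t"
    by (simp add: lookup_add pscale_add_left sum.distrib)
  have "keys (pscale c s) \<subseteq> keys s"
    by (auto simp: in_keys_iff)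
  from plin_superset[OF finite_keys this] show "plin g (pscale c s) = pscale c (plin g s)"
    by (simp add: plin_def pscale_sum_right)
qed

lemma plin_monom [simp]: "plin g (monom u) = g u"
  by (simp add: plin_def)

lemma lin_ext_eq_plin: "lin_ext f = plin (\<lambda>u. monom (f u))"
  by (simp add: fun_eq_iff lin_ext_def plin_def)

lemma plinear_lin_ext: "plinear (lin_ext f)"
  by (simp add: lin_ext_eq_plin plinear_plin)

lemma lin_ext_monom [simp]: "lin_ext f (monom u) = monom (f u)"
  by (simp add: lin_ext_eq_plin)

section \<open>Bilinearity and associativity of the concatenation product\<close>

lemma pmult_eq_plin: "pmult s t = plin (\<lambda>u. plin (\<lambda>v. monom (u \<cdot> v)) t) s"
  by (simp add: pmult_def plin_def pscale_sum_right)

lemma plinear_pmult_left: "plinear (\<lambda>s. pmult s t)"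
  by (simp add: pmult_eq_plin plinear_plin)

lemma plinear_pmult_right: "plinear (pmult s)"
proof -
  have "pmult s t = plin (\<lambda>v. plin (\<lambda>u. monom (u \<cdot> v)) s) t" for t
    unfolding pmult_def plin_def pscale_sum_right
    by (subst sum.swap) (simp add: mult.commute)
  then have "pmult s = plin (\<lambda>v. plin (\<lambda>u. monom (u \<cdot> v)) s)"
    by blast
  then show ?thesis
    by (simp only: plinear_plin)
qed

lemma pmult_monom [simp]: "pmult (monom u) (monom v) = monom (u \<cdot> v)"
  by (simp add: pmult_eq_plin)

lemmas pmult_simps =
  plinear_simps[OF plinear_pmult_left] plinear_simps[OF plinear_pmult_right]

lemma wcat_assoc [simp]: "(u \<cdot> v) \<cdot> w = u \<cdot> (v \<cdot> w)"
  by (induction u rule: bword.induct[where ?P2.0 = "\<lambda>_. True"]) auto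

lemma pmult_assoc: "pmult (pmult s t) r = pmult s (pmult t r)"
proof (induction s rule: poly_mapping_linear_induct)
  case (add s c u)
  have "pmult (pmult (monom u) t) r = pmult (monom u) (pmult t r)"
  proof (induction t rule: poly_mapping_linear_induct)
    case (add t d v)
    have "pmult (monom (u \<cdot> v)) r = pmult (monom u) (pmult (monom v) r)"
      by (rule plinear_eqI[OF plinear_pmult_right plinear_comp[OF plinear_pmult_right plinear_pmult_right]])
        simp
    with add show ?case by (simp add: pmult_simps del: pscale_single)
  qed (simp add: pmult_simps)
  with add show ?case by (simp add: pmult_simps del: pscale_single)
qed (simp add: pmult_simps)

section \<open>A modified Rota-Baxter operator on bracketed words\<close>

lemma letters_wcat [simp]: "letters (u \<cdot> v) = letters u @ letters v"
  by (induction u rule: bword.induct[where ?P2.0 = "\<lambda>_. True"]) auto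

lemma primes_wcat [simp]: "primes (u \<cdot> v) = primes u @ primes v"
  by (induction u rule: bword.induct[where ?P2.0 = "\<lambda>_. True"]) auto

lemma primes_not_Nil [simp]: "primes u \<noteq> []"
  by (cases u) auto

lemma letters_not_Nil [simp]: "letters (u :: 'x bword) \<noteq> []"
  and letters_prm_not_Nil [simp]: "letters_prm (p :: 'x prm) \<noteq> []"
  by (induction u and p rule: bword.induct prm.induct) auto

lemma deg_simps [simp]:
  "deg (u \<cdot> v) = deg u + deg v" "deg (br u) = deg u"
  "deg (PCons p v) = deg (Prime p) + deg v" "deg (Prime (Letter x)) = 1"
  by (simp_all add: deg_def)

lemma deg_pos [simp]: "0 < deg u"
  by (simp add: deg_def)

lemma size_hd_primes: "size (hd (primes u)) < size u"
  by (intro size_prm_primes hd_in_set) simp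

text \<open>
  In the last equation the words \<open>t\<close> occurring in \<open>rb_word lam z\<close> have the degree of \<open>z\<close>, so the
  arguments \<open>x \<cdot> t\<close> keep the degree of \<open>\<lfloor>x\<rfloor>z\<close> but start with a smaller prime element.
\<close>

function rb_word :: "'k \<Rightarrow> 'x bword \<Rightarrow> ('x bword \<Rightarrow>\<^sub>0 'k::comm_ring_1)" where
  "rb_word lam (Prime p) = monom (br (Prime p))"
| "rb_word lam (PCons (Letter a) z) = monom (br (PCons (Letter a) z))"
| "rb_word lam (PCons (Bracket x) z) =
     pmult (monom (br x)) (rb_word lam z)
     - (\<Sum>t\<in>keys (rb_word lam z). pscale (lookup (rb_word lam z) t) (rb_word lam (x \<cdot> t)))
     - pscale lam (monom (x \<cdot> z))"
  by pat_completeness auto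

section \<open>Supports of values and termination of the recursion\<close>

lemma keys_pscale: "keys (pscale c s) \<subseteq> keys s"
  by (auto simp: in_keys_iff)

lemma keys_plin: "keys (plin g s) \<subseteq> (\<Union>u\<in>keys s. keys (g u))"
  unfolding plin_def using keys_pscale by (fast dest: subsetD[OF keys_sum])

lemma keys_pmult: "keys (pmult s t) \<subseteq> {u \<cdot> v | u v. u \<in> keys s \<and> v \<in> keys t}"
proof -
  have "keys (plin (\<lambda>v. monom (u \<cdot> v)) t) \<subseteq> {u \<cdot> v | v. v \<in> keys t}" for u
    using keys_plin[of "\<lambda>v. monom (u \<cdot> v)" t] by fastforce
  then show ?thesis
    unfolding pmult_eq_plin using keys_plin[of _ s] by fast
qed

lemma keys_monom: "keys (monom u) \<subseteq> {u}"
  by simp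

text \<open>The assumption has the shape of the last equation of \<open>rb_word\<close>. Both the
  degree argument and the preservation of irreducibility start from this case distinction.\<close>

lemma keys_rb_word_step:
  assumes "t \<in> keys (pmult (monom u) s - (\<Sum>r\<in>keys s. pscale (lookup s r) (g r))
    - pscale c (monom v))"
  shows "(\<exists>r\<in>keys s. t = u \<cdot> r \<or> t \<in> keys (g r)) \<or> t = v"
proof -
  let ?g = "\<Sum>r\<in>keys s. pscale (lookup s r) (g r)"
  from assms consider "t \<in> keys (pmult (monom u) s)" | "t \<in> keys ?g" | "t \<in> keys (pscale c (monom v))"
    using keys_diff[of "pmult (monom u) s - ?g" "pscale c (monom v)"]
      keys_diff[of "pmult (monom u) s" ?g] by blast
  then show ?thesis
  proof cases
    case 1
    then show ?thesis using keys_pmult[of "monom u" s] by auto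
  next
    case 2
    then show ?thesis using keys_plin[of g s] unfolding plin_def by blast
  next
    case 3
    then show ?thesis using keys_pscale[of c "monom v"] keys_monom[of v] by blast
  qed
qed

text \<open>The recursion is nested: the call on \<open>x \<cdot> t\<close> decreases only because
  \<open>t\<close> has the degree of \<open>z\<close>. So degrees are controlled on the domain of
  the recursion before termination is known.\<close>

lemma deg_rb_word_aux:
  "rb_word_dom (lam, w) \<Longrightarrow> t \<in> keys (rb_word lam w) \<Longrightarrow> deg t = deg w"
proof (induction lam w arbitrary: t rule: rb_word.pinduct)
  case (3 lam x z)
  from keys_rb_word_step[OF "3.prems"[unfolded rb_word.psimps(3)[OF "3.hyps"]]]
  show ?case
  proof (elim disjE bexE)
    fix r assume r: "r \<in> keys (rb_word lam z)" "t \<in> keys (rb_word lam (x \<cdot> r))"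
    show ?thesis using "3.IH"(1)[OF r(1)] "3.IH"(4)[OF r] by simp
  qed (use "3.IH"(1) in auto)
qed (auto simp: rb_word.psimps split: if_splits)

termination rb_word
proof (relation "measures [\<lambda>(lam, w). deg w, \<lambda>(lam, w). size (hd (primes w))]")
  fix lam :: "'k::comm_ring_1" and x z t :: "'x bword"
  assume "rb_word_dom (lam, z)" "t \<in> keys (rb_word lam z)"
  then have "deg t = deg z" by (rule deg_rb_word_aux)
  then show "((lam, x \<cdot> t), (lam, PCons (Bracket x) z))
      \<in> measures [\<lambda>(lam, w). deg w, \<lambda>(lam, w). size (hd (primes w))]"
    using size_hd_primes[of x] by simp
qed simp_all

section \<open>The linear operator and its modified Rota-Baxter identity\<close>

definition rb_op :: "'k \<Rightarrow> ('x bword \<Rightarrow>\<^sub>0 'k) \<Rightarrow> ('x bword \<Rightarrow>\<^sub>0 'k::comm_ring_1)" where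
  "rb_op lam = plin (rb_word lam)"

lemma plinear_rb_op: "plinear (rb_op lam)"
  by (simp add: rb_op_def plinear_plin)

lemmas rb_op_simps = plinear_simps[OF plinear_rb_op]

lemma rb_op_monom [simp]: "rb_op lam (monom w) = rb_word lam w"
  by (simp add: rb_op_def)

lemmas plinear_intros = plinear_id plinear_rb_op plinear_pmult_left plinear_pmult_right
  plinear_comp[OF plinear_rb_op] plinear_comp[OF plinear_pmult_left]
  plinear_comp[OF plinear_pmult_right] plinear_plus plinear_subtract plinear_scaled

text \<open>The sum in the defining equation is the linear extension applied to
  \<open>x P(z)\<close>; it is spelled out there because the extended operator is built from
  \<open>rb_word\<close> itself.\<close>

lemma rb_word_Bracket:
  "rb_word lam (PCons (Bracket x) z) =
     pmult (monom (br x)) (rb_op lam (monom z)) - rb_op lam (pmult (monom x) (rb_op lam (monom z)))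
     - pscale lam (pmult (monom x) (monom z))"
proof -
  have "rb_op lam (pmult (monom x) s) = (\<Sum>t\<in>keys s. pscale (lookup s t) (rb_word lam (x \<cdot> t)))" for s
    using plinear_eqI[of "\<lambda>s. rb_op lam (pmult (monom x) s)" "plin (\<lambda>t. rb_word lam (x \<cdot> t))" s]
    by (simp add: plinear_intros plinear_plin plin_def)
  then show ?thesis by simp
qed

declare rb_word.simps(3) [simp del]

lemma rb_op_Bracket:
  "rb_op lam (pmult (monom (br x)) s) =
     pmult (monom (br x)) (rb_op lam s) - rb_op lam (pmult (monom x) (rb_op lam s))
     - pscale lam (pmult (monom x) s)"
  by (rule plinear_eqI) (intro plinear_intros, intro plinear_intros, simp add: rb_word_Bracket)

definition rb_identity :: "'k \<Rightarrow> ('x bword \<Rightarrow>\<^sub>0 'k) \<Rightarrow> ('x bword \<Rightarrow>\<^sub>0 'k::comm_ring_1) \<Rightarrow> bool" where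
  "rb_identity lam a b \<longleftrightarrow> pmult (rb_op lam a) (rb_op lam b) =
     rb_op lam (pmult (rb_op lam a) b) + rb_op lam (pmult a (rb_op lam b)) + pscale lam (pmult a b)"

text \<open>The identity is linear in its first argument. The map \<open>F\<close> is there for
  \<open>F(s) = x s\<close> with \<open>s = P(z)\<close>, where the induction hypotheses speak of
  the words \<open>x \<cdot> t\<close>.\<close>

lemma rb_identity_linear:
  assumes "\<And>t. t \<in> keys s \<Longrightarrow> rb_identity lam (F (monom t)) b" and F: "plinear F"
  shows "rb_identity lam (F s) b"
  unfolding rb_identity_def
  by (rule plinear_eqI[where s = s])
    (use assms in \<open>auto simp: rb_identity_def intro!: plinear_intros intro: plinear_comp[OF _ F]\<close>)

text \<open>If \<open>P(w) = \<lfloor>w\<rfloor>\<close>, the identity is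
  \<open>rb_op_Bracket\<close> rearranged. For \<open>w = \<lfloor>x\<rfloor>z\<close>, expanding
  \<open>P(w)\<close> and using the identity for the pairs \<open>(z, b)\<close> and
  \<open>(x P(z), b)\<close> makes all terms cancel.\<close>

lemma rb_identity_word: "rb_identity lam (monom w) b"
proof (induction lam w arbitrary: b rule: rb_word.induct)
  case (1 lam p)
  show ?case
    by (simp add: rb_identity_def rb_op_Bracket)
next
  case (2 lam a z)
  show ?case
    by (simp add: rb_identity_def rb_op_Bracket)
next
  case (3 lam x z)
  let ?P = "rb_op lam" and ?x = "monom x" and ?z = "monom z" and ?bx = "monom (br x)"
  have z: "pmult (?P ?z) (?P b) = ?P (pmult (?P ?z) b) + ?P (pmult ?z (?P b)) + pscale lam (pmult ?z b)"
    using "3.IH"(1)[of b] by (simp add: rb_identity_def)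
  have "rb_identity lam (pmult ?x (?P ?z)) b"
    by (rule rb_identity_linear[OF _ plinear_pmult_right]) (use "3.IH" in auto)
  \<comment> \<open>Solved for the nested term, so that unfolding removes it from the right-hand
    side.\<close>
  then have xz: "?P (pmult (?P (pmult ?x (?P ?z))) b) = pmult (?P (pmult ?x (?P ?z))) (?P b)
      - ?P (pmult ?x (pmult (?P ?z) (?P b))) - pscale lam (pmult ?x (pmult (?P ?z) b))"
    by (simp add: rb_identity_def pmult_assoc)
  have w: "monom (PCons (Bracket x) z) = pmult ?bx ?z"
    by simp
  have "rb_identity lam (pmult ?bx ?z) b"
    unfolding rb_identity_def rb_op_Bracket pmult_assoc pmult_simps rb_op_simps xz z
    by (simp add: pscale_add_right pscale_diff_right algebra_simps del: pmult_monom rb_op_monom)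
  then show ?case by (simp only: w)
qed

theorem rb_op_modified_rota_baxter:
  "pmult (rb_op lam a) (rb_op lam b) =
     rb_op lam (pmult (rb_op lam a) b + pmult a (rb_op lam b)) + pscale lam (pmult a b)"
  using rb_identity_linear[of a lam "\<lambda>s. s" b, OF rb_identity_word plinear_id]
  by (simp add: rb_identity_def rb_op_simps)

section \<open>Star words and irreducible words\<close>

abbreviation embed_word :: "'x bword \<Rightarrow> 'x option bword" where
  "embed_word \<equiv> map_bword Some"

lemma wsubst_embed [simp]: "wsubst (embed_word (w :: 'x bword)) u = w"
  and wsubst_prm_embed [simp]: "wsubst_prm (map_prm Some (p :: 'x prm)) u = Prime p"
  by (induction w and p rule: bword.induct prm.induct) auto

lemma None_notin_letters_embed [simp]: "None \<notin> set (letters (embed_word (w :: 'x bword)))"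
  and None_notin_letters_prm_embed [simp]: "None \<notin> set (letters_prm (map_prm Some (p :: 'x prm)))"
  by (induction w and p rule: bword.induct prm.induct) auto

lemma wsubst_wcat [simp]: "wsubst (q \<cdot> r) u = wsubst q u \<cdot> wsubst r u"
  by (induction q rule: bword.induct[where ?P2.0 = "\<lambda>_. True"]) auto

lemma wsubst_without_star:
  "None \<notin> set (letters (q :: 'x option bword)) \<Longrightarrow> wsubst q u = wsubst q v"
  and wsubst_prm_without_star:
  "None \<notin> set (letters_prm (p :: 'x option prm)) \<Longrightarrow> wsubst_prm p u = wsubst_prm p v"
proof (induction q and p rule: bword.induct prm.induct)
  case (PCons p w)
  then have "wsubst_prm p u = wsubst_prm p v" "wsubst w u = wsubst w v"
    by simp_all
  then show ?case by simp
next
  case (Bracket w)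
  then have "wsubst w u = wsubst w v" by simp
  then show ?case by simp
qed (auto split: option.splits)

lemma count_list_eq_1_append:
  "count_list (xs @ ys) a = 1 \<longleftrightarrow>
     count_list xs a = 1 \<and> a \<notin> set ys \<or> a \<notin> set xs \<and> count_list ys a = 1"
  by (auto simp: count_list_0_iff[symmetric] add_is_1)

text \<open>In a concatenation the single star lies in exactly one factor. Hence every context
  arises from the star by bracketing and by multiplying with star-free words.\<close>

lemma star_words_induct [consumes 1, case_names star Bracket wcat_left wcat_right]:
  assumes "q \<in> star_words"
    and star: "Q (letter None)"
    and bracket: "\<And>q. q \<in> star_words \<Longrightarrow> Q q \<Longrightarrow> Q (br q)"
    and left: "\<And>q r. q \<in> star_words \<Longrightarrow> None \<notin> set (letters r) \<Longrightarrow> Q q \<Longrightarrow> Q (q \<cdot> r)"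
    and right: "\<And>q r. q \<in> star_words \<Longrightarrow> None \<notin> set (letters r) \<Longrightarrow> Q q \<Longrightarrow> Q (r \<cdot> q)"
  shows "Q q"
proof -
  have "count_list (letters q) None = 1 \<Longrightarrow> Q q"
    and "count_list (letters_prm p) None = 1 \<Longrightarrow> Q (Prime p)" for p :: "'a option prm"
  proof (induction q and p rule: bword.induct prm.induct)
    case (PCons p w)
    then consider "count_list (letters_prm p) None = 1" "None \<notin> set (letters w)" "Q (Prime p)"
      | "count_list (letters w) None = 1" "None \<notin> set (letters_prm p)" "Q w"
      using count_list_eq_1_append[of "letters_prm p" "letters w" None] by auto
    then show ?case
    proof cases
      case 1
      then show ?thesis using left[of "Prime p" w] by (simp add: star_words_def)
    next
      case 2
      then show ?thesis using right[of w "Prime p"] by (simp add: star_words_def)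
    qed
  next
    case (Letter x)
    then show ?case using star by (cases x) auto
  next
    case (Bracket w)
    then show ?case using bracket[of w] by (simp add: star_words_def)
  qed simp
  then show ?thesis
    using assms(1) by (simp add: star_words_def)
qed

lemma star_words_intros [simp, intro]:
  "letter None \<in> star_words"
  "q \<in> star_words \<Longrightarrow> br q \<in> star_words"
  "q \<in> star_words \<Longrightarrow> q \<cdot> embed_word w \<in> star_words"
  "q \<in> star_words \<Longrightarrow> embed_word w \<cdot> q \<in> star_words"
  by (simp_all add: star_words_def count_notin)

section \<open>Irreducible words by recursion\<close>

primrec irr :: "'x bword \<Rightarrow> bool" and irr_prm :: "'x prm \<Rightarrow> bool" where
  "irr (Prime p) = irr_prm p"
| "irr (PCons p w) = (irr_prm p \<and> irr w)"
| "irr_prm (Letter x) = True"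
| "irr_prm (Bracket w) = (irr w \<and> (\<forall>x y. w \<noteq> br x \<cdot> y))"

lemma irr_wcat [simp]: "irr (u \<cdot> v) \<longleftrightarrow> irr u \<and> irr v"
  by (induction u rule: bword.induct[where ?P2.0 = "\<lambda>_. True"]) auto

lemma not_irr_wsubst: "q \<in> star_words \<Longrightarrow> \<not> irr u \<Longrightarrow> \<not> irr (wsubst q u)"
  by (induction rule: star_words_induct) auto

text \<open>The context is built along the recursion, descending to a bracket whose content starts
  with a bracket and has a further factor.\<close>

lemma not_irr_imp_reducible:
  "\<not> irr (w :: 'x bword) \<Longrightarrow> \<exists>q x y. q \<in> star_words \<and> w = wsubst q (br (br x \<cdot> y))"
  and not_irr_prm_imp_reducible:
  "\<not> irr_prm (p :: 'x prm) \<Longrightarrow> \<exists>q x y. q \<in> star_words \<and> Prime p = wsubst q (br (br x \<cdot> y))"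
proof (induction w and p rule: bword.induct prm.induct)
  case (PCons p w)
  then consider "\<not> irr_prm p" | "\<not> irr w" by auto
  then show ?case
  proof cases
    case 1
    with PCons.IH(1) obtain q x y where "q \<in> star_words" "Prime p = wsubst q (br (br x \<cdot> y))"
      by blast
    then have "q \<cdot> embed_word w \<in> star_words \<and> PCons p w = wsubst (q \<cdot> embed_word w) (br (br x \<cdot> y))"
      by (auto simp flip: wcat.simps(1) simp del: wcat.simps)
    then show ?thesis by blast
  next
    case 2
    with PCons.IH(2) obtain q x y where q: "q \<in> star_words" "w = wsubst q (br (br x \<cdot> y))"
      by blast
    then have "embed_word (Prime p) \<cdot> q \<in> star_words
        \<and> PCons p w = wsubst (embed_word (Prime p) \<cdot> q) (br (br x \<cdot> y))"
      using star_words_intros(4)[OF q(1), of "Prime p"] by simp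
    then show ?thesis by blast
  qed
next
  case (Bracket w)
  show ?case
  proof (cases "irr w")
    case True
    with Bracket.prems obtain x y where "w = br x \<cdot> y" by auto
    then have "letter None \<in> star_words \<and> br w = wsubst (letter None) (br (br x \<cdot> y))"
      by simp
    then show ?thesis by blast
  next
    case False
    with Bracket.IH obtain q x y where "q \<in> star_words" "w = wsubst q (br (br x \<cdot> y))"
      by blast
    then have "br q \<in> star_words \<and> br w = wsubst (br q) (br (br x \<cdot> y))"
      by simp
    then show ?thesis by blast
  qed
qed auto

lemma Irr_mrbl_eq: "Irr_mrbl = {w. irr w}"
proof -
  have "\<not> irr (br (br x \<cdot> y))" for x y :: "'a bword"
    by auto
  then show ?thesis
    unfolding Irr_mrbl_def using not_irr_wsubst not_irr_imp_reducible by blast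
qed

text \<open>A bracket around a prime, or around a word starting with a letter, creates no forbidden
  pattern. For \<open>\<lfloor>x\<rfloor>z\<close> the terms are
  \<open>\<lfloor>x\<rfloor>r\<close>, those of \<open>P(x r)\<close>, and \<open>x z\<close>, with
  \<open>r\<close> from \<open>P(z)\<close>; concatenation preserves irreducibility.\<close>

lemma irr_rb_word: "irr w \<Longrightarrow> t \<in> keys (rb_word lam w) \<Longrightarrow> irr t"
proof (induction lam w arbitrary: t rule: rb_word.induct)
  case (3 lam x z)
  have xz: "irr x" "irr z" "irr (br x)"
    using "3.prems"(1) by auto
  note z = "3.IH"(1)[OF xz(2)]
  from keys_rb_word_step[OF "3.prems"(2)[unfolded rb_word.simps(3)]]
  show ?case
  proof (elim disjE bexE)
    fix r assume r: "r \<in> keys (rb_word lam z)" "t \<in> keys (rb_word lam (x \<cdot> r))"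
    have "irr (x \<cdot> r)" using xz z[OF r(1)] by simp
    then show ?thesis using "3.IH"(4)[OF r(1) _ r(2)] by simp
  qed (use xz z in simp_all)
qed (auto split: if_splits)

section \<open>Normal forms\<close>

text \<open>Evaluation of words in the module of words itself, with \<open>rb_op\<close> taking the
  place of the bracket.\<close>

primrec nf_word :: "'k \<Rightarrow> 'x bword \<Rightarrow> ('x bword \<Rightarrow>\<^sub>0 'k::comm_ring_1)"
  and nf_prm :: "'k \<Rightarrow> 'x prm \<Rightarrow> ('x bword \<Rightarrow>\<^sub>0 'k)" where
  "nf_word lam (Prime p) = nf_prm lam p"
| "nf_word lam (PCons p w) = pmult (nf_prm lam p) (nf_word lam w)"
| "nf_prm lam (Letter x) = monom (letter x)"
| "nf_prm lam (Bracket w) = rb_op lam (nf_word lam w)"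

definition nf :: "'k \<Rightarrow> ('x bword \<Rightarrow>\<^sub>0 'k) \<Rightarrow> ('x bword \<Rightarrow>\<^sub>0 'k::comm_ring_1)" where
  "nf lam = plin (nf_word lam)"

lemma plinear_nf: "plinear (nf lam)"
  by (simp add: nf_def plinear_plin)

lemmas nf_simps = plinear_simps[OF plinear_nf]

lemma nf_monom [simp]: "nf lam (monom w) = nf_word lam w"
  by (simp add: nf_def)

lemma nf_word_wcat [simp]: "nf_word lam (u \<cdot> v) = pmult (nf_word lam u) (nf_word lam v)"
  by (induction u rule: bword.induct[where ?P2.0 = "\<lambda>_. True"]) (auto simp: pmult_assoc)

lemma nf_pmult: "nf lam (pmult s t) = pmult (nf lam s) (nf lam t)"
proof (rule plinear_eqI[where s = s])
  fix u
  show "nf lam (pmult (monom u) t) = pmult (nf lam (monom u)) (nf lam t)"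
    by (rule plinear_eqI[where s = t])
      (auto intro!: plinear_comp[OF plinear_nf] plinear_comp[OF plinear_pmult_right] plinear_intros plinear_nf)
qed (auto intro!: plinear_comp[OF plinear_nf] plinear_comp[OF plinear_pmult_left] plinear_intros plinear_nf)

lemma nf_lin_ext_br: "nf lam (lin_ext br s) = rb_op lam (nf lam s)"
  by (rule plinear_eqI[where s = s])
    (auto intro!: plinear_comp[OF plinear_nf] plinear_comp[OF plinear_rb_op] plinear_lin_ext plinear_nf)

text \<open>The relation becomes an instance of the modified Rota-Baxter identity of
  \<open>rb_op\<close>.\<close>

lemma nf_S_mrbl:
  assumes "s \<in> S_mrbl lam"
  shows "nf lam s = 0"
proof -
  obtain x y where s: "s = monom (br (br x \<cdot> y)) + monom (br (x \<cdot> br y))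
      + pscale lam (monom (x \<cdot> y)) - monom (br x \<cdot> br y)"
    using assms by (auto simp: S_mrbl_def)
  show ?thesis
    unfolding s nf_simps nf_monom nf_word_wcat nf_word.simps(1) nf_prm.simps(2)
    by (simp add: rb_op_modified_rota_baxter rb_op_simps)
qed

text \<open>Irreducibility of \<open>\<lfloor>w\<rfloor>\<close> excludes exactly the words
  \<open>w\<close> treated by the last equation of \<open>rb_word\<close>.\<close>

lemma rb_word_irr: "irr (br w) \<Longrightarrow> rb_word lam w = monom (br w)"
  by (cases "(lam, w)" rule: rb_word.cases) auto

lemma nf_word_irr:
  "irr (w :: 'x bword) \<Longrightarrow> nf_word lam w = monom w"
  and nf_prm_irr: "irr_prm (p :: 'x prm) \<Longrightarrow> nf_prm lam p = monom (Prime p)"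
proof (induction w and p rule: bword.induct prm.induct)
  case (Bracket w)
  then have "nf_word lam w = monom w" by simp
  then show ?case using rb_word_irr[of w lam] Bracket.prems by simp
qed auto

lemma irr_rb_op:
  assumes "\<And>u. u \<in> keys s \<Longrightarrow> irr u" "t \<in> keys (rb_op lam s)"
  shows "irr t"
proof -
  obtain u where "u \<in> keys s" "t \<in> keys (rb_word lam u)"
    using assms(2) keys_plin[of "rb_word lam" s] unfolding rb_op_def by blast
  then show ?thesis
    by (blast intro: irr_rb_word assms(1))
qed

lemma irr_pmult:
  assumes "\<And>u. u \<in> keys s \<Longrightarrow> irr u" "\<And>u. u \<in> keys r \<Longrightarrow> irr u" "t \<in> keys (pmult s r)"
  shows "irr t"
proof -
  obtain u v where "t = u \<cdot> v" "u \<in> keys s" "v \<in> keys r"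
    using assms(3) keys_pmult[of s r] by blast
  then show ?thesis
    using assms(1,2) by simp
qed

lemma irr_nf_word: "t \<in> keys (nf_word lam (w :: 'x bword)) \<Longrightarrow> irr t"
  and irr_nf_prm: "t \<in> keys (nf_prm lam (p :: 'x prm)) \<Longrightarrow> irr t"
proof (induction w and p arbitrary: t and t rule: bword.induct prm.induct)
  case (PCons p w)
  from PCons.prems show ?case
    unfolding nf_word.simps by (rule irr_pmult[rotated 2]) (erule PCons.IH)+
next
  case (Bracket w)
  from Bracket.prems show ?case
    unfolding nf_prm.simps by (rule irr_rb_op[rotated]) (erule Bracket.IH)
qed (auto split: if_splits)

lemma irr_nf: "t \<in> keys (nf lam s) \<Longrightarrow> irr t"
  unfolding nf_def using keys_plin[of "nf_word lam" s] by (blast intro: irr_nf_word)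

lemma nf_of_irr: "keys s \<subseteq> {w. irr w} \<Longrightarrow> nf lam s = s"
  by (rule plinear_eqI[OF plinear_nf plinear_id]) (auto simp: nf_word_irr)

section \<open>Compatibility of the order with contexts\<close>

text \<open>
  The paths of \<open>w\<close> as a factor of a longer word, without the leading \<open>\<mu>\<close>: a word of breadth one
  gains a \<open>\<mu>\<close> when it becomes a factor, a longer word does not.
\<close>

definition factor_paths :: "'x bword \<Rightarrow> 'x path_sym list list" where
  "factor_paths w = concat (map (\<lambda>p. paths (Prime p)) (primes w))"

lemma factor_paths_simps [simp]:
  "factor_paths (Prime p) = paths (Prime p)"
  "factor_paths (PCons p w) = paths (Prime p) @ factor_paths w"
  "factor_paths (u \<cdot> v) = factor_paths u @ factor_paths v"
  by (simp_all add: factor_paths_def)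

lemma paths_PCons: "paths (PCons p w) = map (Cons Mu_sym) (factor_paths (PCons p w))"
  by (simp add: factor_paths_def)

declare paths.simps(3) [simp del]

lemma paths_wcat: "paths (u \<cdot> v) = map (Cons Mu_sym) (factor_paths (u \<cdot> v))"
  by (cases u) (simp_all add: paths_PCons)

lemma length_paths: "length (paths w) = deg w \<and> length (factor_paths w) = deg w"
  and length_paths_Prime: "length (paths (Prime p)) = deg (Prime p)"
  for w :: "'x bword" and p :: "'x prm"
  by (induction w and p rule: bword.induct prm.induct) (simp_all add: paths_PCons)

lemma paths_not_Nil [simp]: "paths w \<noteq> []" "factor_paths w \<noteq> []"
  by (metis deg_pos length_greater_0_conv length_paths)+

text \<open>
  The order \<open>pl_le\<close> is not compatible with contexts: \<open>\<lfloor>xy\<rfloor> < \<lfloor>x\<rfloor>y\<close> but \<open>z\<lfloor>x\<rfloor>y < z\<lfloor>xy\<rfloor>\<close>. The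
  following stronger relation is compatible and still holds between the monomials of the relations.
\<close>

definition path_less :: "'x bword \<Rightarrow> 'x bword \<Rightarrow> bool" where
  "path_less u v \<longleftrightarrow> (paths u, paths v) \<in> lex (measure length)
     \<and> (factor_paths u, factor_paths v) \<in> lex (measure length)"

lemma lex_measure_map_Cons:
  assumes "(xs, ys) \<in> lex (measure length)"
  shows "(map (Cons a) xs, map (Cons a) ys) \<in> lex (measure length)"
proof -
  obtain l x y xs' ys' where "length xs = length ys" "xs = l @ x # xs'" "ys = l @ y # ys'"
    "length x < length y"
    using assms by (auto simp: lex_conv)
  then have "map (Cons a) xs = map (Cons a) l @ (a # x) # map (Cons a) xs'"
    "map (Cons a) ys = map (Cons a) l @ (a # y) # map (Cons a) ys'"
    "length (map (Cons a) xs) = length (map (Cons a) ys)" "(a # x, a # y) \<in> measure length"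
    by simp_all
  then show ?thesis
    unfolding lex_conv by blast
qed

lemma path_less_br: "path_less u v \<Longrightarrow> path_less (br u) (br v)"
  by (simp add: path_less_def lex_measure_map_Cons)

lemma path_less_wcat_left: "path_less u v \<Longrightarrow> path_less (r \<cdot> u) (r \<cdot> v)"
  by (simp add: path_less_def paths_wcat lex_append_leftI lex_measure_map_Cons del: map_append)

lemma path_less_wcat_right: "path_less u v \<Longrightarrow> path_less (u \<cdot> r) (v \<cdot> r)"
  by (simp add: path_less_def paths_wcat lex_append_rightI lex_measure_map_Cons del: map_append)

text \<open>Bracketing is governed by \<open>paths\<close>, multiplication by
  \<open>factor_paths\<close>. Carrying both comparisons makes the relation pass through every
  context.\<close>

lemma path_less_wsubst: "q \<in> star_words \<Longrightarrow> path_less u v \<Longrightarrow> path_less (wsubst q u) (wsubst q v)"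
proof (induction rule: star_words_induct)
  case (wcat_left q r)
  then show ?case using wsubst_without_star[of r u v] path_less_wcat_right by simp
next
  case (wcat_right q r)
  then show ?case using wsubst_without_star[of r u v] path_less_wcat_left by simp
qed (auto intro: path_less_br)

lemma path_sym_less_irrefl: "(a, a) \<notin> path_sym_less"
  by (auto simp: path_sym_less_def)

text \<open>At the first differing path the longer one is larger in the degree lexicographical
  order, whatever its symbols. Equally long path lists mean equal degrees.\<close>

lemma path_less_imp_strictly:
  assumes "path_less u v"
  shows "strictly pl_le u v"
proof -
  let ?R = "lenlex path_sym_less :: ('a path_sym list \<times> _) set"
  have irrefl: "(p, p) \<notin> ?R" for p
    by (intro lenlex_irreflexive path_sym_less_irrefl)
  obtain l p p' r r' where paths: "paths u = l @ p # r" "paths v = l @ p' # r'"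
    and len: "length (paths u) = length (paths v)" "length p < length p'"
    using assms unfolding path_less_def lex_conv by auto
  have "(p, p') \<in> ?R" "(p', p) \<notin> ?R"
    using len(2) by (auto simp: lenlex_conv)
  \<comment> \<open>Irreflexivity on single paths allows the common prefix \<open>l\<close> to be
    cancelled.\<close>
  then have "(paths u, paths v) \<in> lex ?R" "(paths v, paths u) \<notin> lex ?R"
    using len len(2) irrefl unfolding paths by (auto simp: lex_append_left_iff)
  moreover have "paths u \<noteq> paths v"
    using len(2) unfolding paths by auto
  moreover have "deg u = deg v"
    using len(1) length_paths by metis
  ultimately show ?thesis
    by (auto simp: strictly_def pl_le_def)
qed

lemma path_less_irrefl: "\<not> path_less u u"
  by (auto simp: path_less_def lex_conv)

section \<open>Length of the path of the first letter\<close>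

definition hd_depth :: "'x bword \<Rightarrow> nat" where
  "hd_depth w = length (hd (paths w))"

definition factor_hd_depth :: "'x bword \<Rightarrow> nat" where
  "factor_hd_depth w = length (hd (factor_paths w))"

lemma hd_depth_simps [simp]:
  "hd_depth (u \<cdot> v) = Suc (factor_hd_depth u)"
  "hd_depth (br u) = Suc (hd_depth u)"
  "factor_hd_depth (u \<cdot> v) = factor_hd_depth u"
  "factor_hd_depth (br u) = Suc (hd_depth u)"
  by (simp_all add: hd_depth_def factor_hd_depth_def paths_wcat hd_map hd_append del: map_append)

text \<open>The two lengths, which count the letter itself, differ at most by the leading
  \<open>\<mu>\<close>, present exactly when the breadth is at least two.\<close>

lemma factor_hd_depth_le: "factor_hd_depth u \<le> hd_depth u"
  by (cases u) (simp_all add: hd_depth_def factor_hd_depth_def paths_PCons hd_map hd_append)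

lemma hd_depth_le: "hd_depth u \<le> Suc (factor_hd_depth u)"
  by (cases u) (simp_all add: hd_depth_def factor_hd_depth_def paths_PCons hd_map hd_append)

lemma lex_measure_hd:
  "\<lbrakk>length xs = length ys; xs \<noteq> []; length (hd xs) < length (hd ys)\<rbrakk> \<Longrightarrow> (xs, ys) \<in> lex (measure length)"
  by (cases xs; cases ys) auto

text \<open>Equal degrees give lists of equal length, and the comparison is already decided at their
  first entries.\<close>

lemma path_lessI:
  assumes "deg u = deg v" "hd_depth u < hd_depth v" "factor_hd_depth u < factor_hd_depth v"
  shows "path_less u v"
  using assms length_paths[of u] length_paths[of v]
  by (auto simp: path_less_def hd_depth_def factor_hd_depth_def intro!: lex_measure_hd)

text \<open>With \<open>d = hd_depth x\<close>, the first path of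
  \<open>\<lfloor>\<lfloor>x\<rfloor>y\<rfloor>\<close> has length \<open>d + 3\<close>, those of
  the other words at most \<open>d + 2\<close>.\<close>

lemma path_less_relation:
  "path_less (br (x \<cdot> br y)) (br (br x \<cdot> y))"
  "path_less (x \<cdot> y) (br (br x \<cdot> y))"
  "path_less (br x \<cdot> br y) (br (br x \<cdot> y))"
  using factor_hd_depth_le[of x] hd_depth_le[of x] by (auto intro!: path_lessI simp del: wcat.simps)

text \<open>With \<open>d = hd_depth u\<close>, the first path of the ambiguity has length
  \<open>d + 5\<close>. The words on the left, with first paths of length at most
  \<open>d + 4\<close>, are the leading words of the six terms in the overlap identity.\<close>

lemma path_less_composition:
  "path_less (br (br u \<cdot> (v \<cdot> br y))) (br (br (br u \<cdot> v) \<cdot> y))"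
  "path_less (br (br u \<cdot> v) \<cdot> br y) (br (br (br u \<cdot> v) \<cdot> y))"
  "path_less (br (br (u \<cdot> br v) \<cdot> y)) (br (br (br u \<cdot> v) \<cdot> y))"
  "path_less (br (br u \<cdot> (br v \<cdot> y))) (br (br (br u \<cdot> v) \<cdot> y))"
  "path_less (br (u \<cdot> br (br v \<cdot> y))) (br (br (br u \<cdot> v) \<cdot> y))"
  "path_less (br u \<cdot> br (br v \<cdot> y)) (br (br (br u \<cdot> v) \<cdot> y))"
  using factor_hd_depth_le[of u] hd_depth_le[of u]
  by (auto intro!: path_lessI simp del: wcat.simps)

section \<open>Triviality of the compositions\<close>

text \<open>The relations are extended bilinearly from words to all elements, so that reductions can
  be carried out inside an argument.\<close>

definition mrb_rel :: "'k \<Rightarrow> ('x bword \<Rightarrow>\<^sub>0 'k) \<Rightarrow> ('x bword \<Rightarrow>\<^sub>0 'k) \<Rightarrow> ('x bword \<Rightarrow>\<^sub>0 'k::comm_ring_1)" where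
  "mrb_rel lam a b = lin_ext br (pmult (lin_ext br a) b) + lin_ext br (pmult a (lin_ext br b))
     + pscale lam (pmult a b) - pmult (lin_ext br a) (lin_ext br b)"

lemma S_mrbl_eq: "S_mrbl lam = {mrb_rel lam (monom x) (monom y) | x y. True}"
  by (simp add: S_mrbl_def mrb_rel_def)

lemmas lin_ext_simps = plinear_simps[OF plinear_lin_ext]

section \<open>Substitution into contexts and leading words of relations\<close>

lemma psubst_monom [simp]: "psubst q (monom u) = monom (wsubst q u)"
  by (simp add: psubst_def)

lemma plinear_psubst: "plinear (psubst q)"
  unfolding psubst_def[abs_def] by (fact plinear_lin_ext)

lemmas psubst_simps = plinear_simps[OF plinear_psubst]

lemma psubst_star [simp]: "psubst (letter None) s = s"
  by (rule plinear_eqI[OF plinear_psubst plinear_id]) simp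

lemma psubst_br: "psubst (br q) s = lin_ext br (psubst q s)"
  by (rule plinear_eqI[OF plinear_psubst plinear_comp[OF plinear_lin_ext plinear_psubst]]) simp

lemma psubst_wcat_embed_right: "psubst (q \<cdot> embed_word w) s = pmult (psubst q s) (monom w)"
  by (rule plinear_eqI[OF plinear_psubst plinear_comp[OF plinear_pmult_left plinear_psubst]]) simp

lemma psubst_wcat_embed_left: "psubst (embed_word w \<cdot> q) s = pmult (monom w) (psubst q s)"
  by (rule plinear_eqI[OF plinear_psubst plinear_comp[OF plinear_pmult_right plinear_psubst]]) simp

lemma psubst_mrb_rel:
  "psubst q (mrb_rel lam (monom x) (monom y)) = monom (wsubst q (br (br x \<cdot> y)))
     + (monom (wsubst q (br (x \<cdot> br y))) + pscale lam (monom (wsubst q (x \<cdot> y)))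
        - monom (wsubst q (br x \<cdot> br y)))"
  unfolding mrb_rel_def lin_ext_monom pmult_monom psubst_simps psubst_monom
  by (simp only: add_diff_eq add.assoc)

text \<open>For a preorder \<open>lead\<close> may have several candidates; strict dominance over
  all other keys leaves only one.\<close>

lemma lead_eqI:
  assumes "m \<in> keys s" "\<And>u. u \<in> keys s \<Longrightarrow> u \<noteq> m \<Longrightarrow> strictly leq u m" "leq m m"
  shows "lead leq s = m"
  unfolding lead_def
proof (rule some_equality)
  show "m \<in> keys s \<and> (\<forall>u\<in>keys s. leq u m)"
    using assms by (auto simp: strictly_def)
qed (use assms in \<open>auto simp: strictly_def\<close>)

lemma lookup_monom: "lookup (monom u) v = (if u = v then 1 else 0)"
  by (simp add: lookup_single when_def)

text \<open>By \<open>path_less\<close> the other three words differ from the leading one, in every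
  context. So its coefficient stays 1 and it dominates strictly.\<close>

lemma
  fixes x y :: "'x::linorder bword" and lam :: "'k::comm_ring_1"
  assumes q: "q \<in> star_words"
  shows lead_psubst_mrb_rel:
      "lead pl_le (psubst q (mrb_rel lam (monom x) (monom y))) = wsubst q (br (br x \<cdot> y))" (is ?lead)
    and lookup_psubst_mrb_rel:
      "lookup (psubst q (mrb_rel lam (monom x) (monom y))) (wsubst q (br (br x \<cdot> y))) = 1" (is ?coeff)
proof -
  let ?m = "wsubst q (br (br x \<cdot> y))" and ?s = "psubst q (mrb_rel lam (monom x) (monom y))"
  let ?M = "{wsubst q (br (x \<cdot> br y)), wsubst q (x \<cdot> y), wsubst q (br x \<cdot> br y)}"
  have less: "path_less u ?m" if "u \<in> ?M" for u
    using that by (elim insertE emptyE) (simp_all only: path_less_wsubst[OF q] path_less_relation)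
  then have "?m \<notin> ?M"
    using path_less_irrefl by blast
  then have "wsubst q (br (x \<cdot> br y)) \<noteq> ?m" "wsubst q (x \<cdot> y) \<noteq> ?m" "wsubst q (br x \<cdot> br y) \<noteq> ?m"
    by (metis insertCI)+
  then show ?coeff
    unfolding psubst_mrb_rel lookup_add lookup_minus lookup_pscale lookup_monom
    by (simp del: wcat.simps)
  then have "?m \<in> keys ?s"
    by (simp add: in_keys_iff del: wcat.simps)
  moreover have "u \<in> ?M" if "u \<in> keys ?s" "u \<noteq> ?m" for u
    using that unfolding psubst_mrb_rel
    by (auto simp: in_keys_iff lookup_add lookup_minus lookup_single when_def simp del: wcat.simps split: if_splits)
  then have "strictly pl_le u ?m" if "u \<in> keys ?s" "u \<noteq> ?m" for u
    using that less path_less_imp_strictly by blast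
  ultimately show ?lead
    by (intro lead_eqI) (auto simp: pl_le_def)
qed

section \<open>Closure properties of trivial elements\<close>

lemma trivial_mod_zero: "trivial_mod leq S w 0"
  unfolding trivial_mod_def by (rule exI[of _ 0]) simp

lemma trivial_mod_add:
  assumes "trivial_mod leq S w g" "trivial_mod leq S w h"
  shows "trivial_mod leq S w (g + h)"
proof -
  obtain n :: nat and c q s where g: "g = (\<Sum>i<n. pscale (c i) (psubst (q i) (s i)))"
    and gi: "\<And>i. i < n \<Longrightarrow> q i \<in> star_words \<and> s i \<in> S \<and> strictly leq (lead leq (psubst (q i) (s i))) w"
    using assms(1) unfolding trivial_mod_def by blast
  obtain m :: nat and d r t where h: "h = (\<Sum>i<m. pscale (d i) (psubst (r i) (t i)))"
    and hi: "\<And>i. i < m \<Longrightarrow> r i \<in> star_words \<and> t i \<in> S \<and> strictly leq (lead leq (psubst (r i) (t i))) w"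
    using assms(2) unfolding trivial_mod_def by blast
  let ?c = "\<lambda>i. if i < n then c i else d (i - n)" and ?q = "\<lambda>i. if i < n then q i else r (i - n)"
    and ?s = "\<lambda>i. if i < n then s i else t (i - n)"
  have "(\<Sum>i<n + m. pscale (?c i) (psubst (?q i) (?s i))) = g + h"
    unfolding g h by (induction m) (simp_all add: add.assoc)
  moreover have "\<forall>i<n + m. ?q i \<in> star_words \<and> ?s i \<in> S
      \<and> strictly leq (lead leq (psubst (?q i) (?s i))) w"
    using gi hi by auto
  ultimately show ?thesis
    unfolding trivial_mod_def
    by (intro exI[of _ "n + m"] exI[of _ ?c] exI[of _ ?q] exI[of _ ?s]) simp
qed

lemma trivial_mod_pscale:
  assumes "trivial_mod leq S w h"
  shows "trivial_mod leq S w (pscale c h)"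
proof -
  obtain n :: nat and d r t where h: "h = (\<Sum>i<n. pscale (d i) (psubst (r i) (t i)))"
    and hi: "\<forall>i<n. r i \<in> star_words \<and> t i \<in> S \<and> strictly leq (lead leq (psubst (r i) (t i))) w"
    using assms unfolding trivial_mod_def by blast
  have "pscale c h = (\<Sum>i<n. pscale (c * d i) (psubst (r i) (t i)))"
    unfolding h by (simp add: pscale_sum_right)
  with hi show ?thesis
    unfolding trivial_mod_def by (intro exI[of _ n] exI[of _ "\<lambda>i. c * d i"] exI[of _ r] exI[of _ t]) simp
qed

lemma trivial_mod_minus: "trivial_mod leq S w h \<Longrightarrow> trivial_mod leq S w (- h)"
  using trivial_mod_pscale[of leq S w h "- 1"] by (simp add: pscale_minus_one)

lemma trivial_mod_diff:
  "trivial_mod leq S w g \<Longrightarrow> trivial_mod leq S w h \<Longrightarrow> trivial_mod leq S w (g - h)"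
  using trivial_mod_add[OF _ trivial_mod_minus, of leq S w g h] by simp

lemmas trivial_mod_intros =
  trivial_mod_add trivial_mod_diff trivial_mod_minus trivial_mod_pscale trivial_mod_zero

text \<open>The basic trivial element: a single term with coefficient 1, whose leading word is known
  explicitly.\<close>

lemma trivial_mod_mrb_rel:
  assumes "q \<in> star_words" "path_less (wsubst q (br (br x \<cdot> y))) w"
  shows "trivial_mod pl_le (S_mrbl lam) w (psubst q (mrb_rel lam (monom x) (monom y)))"
proof -
  let ?s = "mrb_rel lam (monom x) (monom y)"
  have "?s \<in> S_mrbl lam"
    by (auto simp: S_mrbl_eq)
  moreover have "strictly pl_le (lead pl_le (psubst q ?s)) w"
    using assms path_less_imp_strictly by (simp add: lead_psubst_mrb_rel del: wcat.simps)
  ultimately show ?thesis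
    unfolding trivial_mod_def using assms(1)
    by (intro exI[of _ "1::nat"] exI[of _ "\<lambda>_. 1"] exI[of _ "\<lambda>_. q"] exI[of _ "\<lambda>_. ?s"]) simp
qed


lemma trivial_mod_br:
  assumes "path_less (br (br x \<cdot> y)) w"
  shows "trivial_mod pl_le (S_mrbl lam) w (mrb_rel lam (monom x) (monom y))"
  using trivial_mod_mrb_rel[of "letter None" x y w lam] assms by simp

lemma mrb_rel_simps:
  "mrb_rel lam (a + a') b = mrb_rel lam a b + mrb_rel lam a' b"
  "mrb_rel lam (a - a') b = mrb_rel lam a b - mrb_rel lam a' b"
  "mrb_rel lam (pscale c a) b = pscale c (mrb_rel lam a b)"
  "mrb_rel lam a (b + b') = mrb_rel lam a b + mrb_rel lam a b'"
  "mrb_rel lam a (b - b') = mrb_rel lam a b - mrb_rel lam a b'"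
  "mrb_rel lam a (pscale c b) = pscale c (mrb_rel lam a b)"
  by (simp_all add: mrb_rel_def pmult_simps lin_ext_simps pscale_add_right pscale_diff_right
      mult.commute algebra_simps)

section \<open>The including compositions\<close>

context
  fixes lam :: "'k::comm_ring_1" and x y :: "'x::linorder bword"
begin

abbreviation "trivial_rel \<equiv> trivial_mod pl_le (S_mrbl lam) (br (br x \<cdot> y))"

text \<open>Write \<open>r|g = x + rest\<close>. Then
  \<open>f(x, y) = f(r|g, y) - f(rest, y)\<close>, and expanding \<open>f(r|g, y)\<close> produces
  the subtracted term \<open>\<lfloor>\<lfloor>r|g\<rfloor>y\<rfloor>\<close> together with three
  smaller ones.\<close>

lemma trivial_including_composition_left:
  assumes r: "r \<in> star_words" "x = wsubst r (br (br u \<cdot> v))"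
  shows "trivial_rel (mrb_rel lam (monom x) (monom y)
    - psubst (br (br r \<cdot> embed_word y)) (mrb_rel lam (monom u) (monom v)))"
proof -
  let ?g = "mrb_rel lam (monom u) (monom v)" and ?y = "monom y :: 'x bword \<Rightarrow>\<^sub>0 'k"
  let ?rest = "monom (wsubst r (br (u \<cdot> br v))) + pscale lam (monom (wsubst r (u \<cdot> v)))
    - monom (wsubst r (br u \<cdot> br v)) :: 'x bword \<Rightarrow>\<^sub>0 'k"
  have G: "psubst r ?g = monom x + ?rest"
    unfolding r(2) by (rule psubst_mrb_rel)
  have eq: "mrb_rel lam (monom x) ?y - psubst (br (br r \<cdot> embed_word y)) ?g =
      psubst (br (r \<cdot> embed_word (br y))) ?g + pscale lam (psubst (r \<cdot> embed_word y) ?g)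
      - psubst (br r \<cdot> embed_word (br y)) ?g - mrb_rel lam ?rest ?y"
    unfolding psubst_br psubst_wcat_embed_right G mrb_rel_simps
    by (simp add: mrb_rel_def pmult_simps lin_ext_simps pscale_add_right pscale_diff_right algebra_simps
        del: pscale_single)
  \<comment> \<open>Putting a smaller word at the place of the leading word of \<open>g\<close>
    inside \<open>x\<close> lowers the leading word of the relation.\<close>
  have rest: "trivial_rel (mrb_rel lam (monom (wsubst r t)) ?y)"
    if "path_less t (br (br u \<cdot> v))" for t
  proof (rule trivial_mod_br)
    show "path_less (br (br (wsubst r t) \<cdot> y)) (br (br x \<cdot> y))"
      using path_less_wsubst[OF r(1) that] unfolding r(2)
      by (intro path_less_br path_less_wcat_right)
  qed
  have emb: "trivial_rel (psubst q ?g)"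
    if "q \<in> star_words" "path_less (wsubst q (br (br u \<cdot> v))) (br (br x \<cdot> y))" for q
    using that by (rule trivial_mod_mrb_rel)
  show ?thesis
    unfolding eq mrb_rel_simps
    by (intro trivial_mod_intros rest path_less_relation emb)
      (use r path_less_relation in \<open>simp_all del: bword.map prm.map wcat.simps\<close>)
qed

text \<open>The same argument with linearity of the relation in its second argument.\<close>

lemma trivial_including_composition_right:
  assumes r: "r \<in> star_words" "y = wsubst r (br (br u \<cdot> v))"
  shows "trivial_rel (mrb_rel lam (monom x) (monom y)
    - psubst (br (embed_word (br x) \<cdot> r)) (mrb_rel lam (monom u) (monom v)))"
proof -
  let ?g = "mrb_rel lam (monom u) (monom v)" and ?x = "monom x :: 'x bword \<Rightarrow>\<^sub>0 'k"
  let ?rest = "monom (wsubst r (br (u \<cdot> br v))) + pscale lam (monom (wsubst r (u \<cdot> v)))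
    - monom (wsubst r (br u \<cdot> br v)) :: 'x bword \<Rightarrow>\<^sub>0 'k"
  have G: "psubst r ?g = monom y + ?rest"
    unfolding r(2) by (rule psubst_mrb_rel)
  have eq: "mrb_rel lam ?x (monom y) - psubst (br (embed_word (br x) \<cdot> r)) ?g =
      psubst (br (embed_word x \<cdot> br r)) ?g + pscale lam (psubst (embed_word x \<cdot> r) ?g)
      - psubst (embed_word (br x) \<cdot> br r) ?g - mrb_rel lam ?x ?rest"
    unfolding psubst_br psubst_wcat_embed_left G mrb_rel_simps
    by (simp add: mrb_rel_def pmult_simps lin_ext_simps pscale_add_right pscale_diff_right algebra_simps
        del: pscale_single)
  have rest: "trivial_rel (mrb_rel lam ?x (monom (wsubst r t)))"
    if "path_less t (br (br u \<cdot> v))" for t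
  proof (rule trivial_mod_br)
    show "path_less (br (br x \<cdot> wsubst r t)) (br (br x \<cdot> y))"
      using path_less_wsubst[OF r(1) that] unfolding r(2)
      by (intro path_less_br path_less_wcat_left)
  qed
  have emb: "trivial_rel (psubst q ?g)"
    if "q \<in> star_words" "path_less (wsubst q (br (br u \<cdot> v))) (br (br x \<cdot> y))" for q
    using that by (rule trivial_mod_mrb_rel)
  show ?thesis
    unfolding eq mrb_rel_simps
    by (intro trivial_mod_intros rest path_less_relation emb)
      (use r path_less_relation in \<open>simp_all del: bword.map prm.map wcat.simps\<close>)
qed

end

text \<open>Here the inner occurrence is \<open>\<lfloor>x\<rfloor>\<close> itself rather than a
  subword of \<open>x\<close>, so the six-term identity replaces linearity. Its terms appear in the
  order of \<open>path_less_composition\<close>.\<close>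

lemma trivial_including_composition_overlap:
  "trivial_mod pl_le (S_mrbl lam) (br (br (br u \<cdot> v) \<cdot> y))
     (mrb_rel lam (monom (br u \<cdot> v)) (monom y)
      - psubst (br (letter None \<cdot> embed_word y)) (mrb_rel lam (monom u) (monom v)))"
proof -
  let ?f = "\<lambda>a b. mrb_rel lam (monom a) (monom b)"
  have eq: "?f (br u \<cdot> v) y - psubst (br (letter None \<cdot> embed_word y)) (?f u v) =
      ?f u (v \<cdot> br y) - psubst (letter None \<cdot> embed_word (br y)) (?f u v)
      - ?f (u \<cdot> br v) y + ?f u (br v \<cdot> y)
      - psubst (br (embed_word u \<cdot> letter None)) (?f v y)
      + psubst (embed_word (br u) \<cdot> letter None) (?f v y)"
    unfolding psubst_br psubst_wcat_embed_right psubst_wcat_embed_left psubst_star mrb_rel_def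
    by (simp add: pmult_simps lin_ext_simps pscale_add_right pscale_diff_right algebra_simps
        del: wcat.simps pscale_single)
  show ?thesis
    unfolding eq
    by (intro trivial_mod_intros trivial_mod_br trivial_mod_mrb_rel path_less_composition)
      (use path_less_composition in \<open>simp_all del: bword.map prm.map wcat.simps\<close>)
qed

section \<open>Positions of one leading word inside another\<close>

lemma psubst_cong: "(\<And>w. wsubst q w = wsubst r w) \<Longrightarrow> psubst q s = psubst r s"
  by (rule plinear_eqI[OF plinear_psubst plinear_psubst]) simp

lemma wcat_not_Prime: "u \<cdot> v \<noteq> Prime p"
  by (cases u) auto

lemma wsubst_prm_Prime: "\<exists>p'. wsubst_prm p (Prime a) = Prime p'"
  by (cases p) (auto split: option.splits)

text \<open>The inserted word is prime, so it is the whole word, \<open>\<lfloor>x\<rfloor>\<close>,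
  or lies inside \<open>x\<close> or \<open>y\<close>. Except when it is the whole word, the context
  is described by its effect on substitution, as its star-free parts are known through their
  values.\<close>

lemma including_cases [consumes 2, case_names whole left right overlap]:
  assumes "q \<in> star_words" and eq: "wsubst q (br (br u \<cdot> v)) = br (br x \<cdot> (y :: 'x bword))"
  obtains "q = letter None" "u = x" "v = y"
  | r where "r \<in> star_words" "x = wsubst r (br (br u \<cdot> v))"
      "\<And>w. wsubst q w = wsubst (br (br r \<cdot> embed_word y)) w"
  | r where "r \<in> star_words" "y = wsubst r (br (br u \<cdot> v))"
      "\<And>w. wsubst q w = wsubst (br (embed_word (br x) \<cdot> r)) w"
  | "x = br u \<cdot> v" "\<And>w. wsubst q w = wsubst (br (letter None \<cdot> embed_word y)) w"
proof -
  let ?L = "br (br u \<cdot> v)"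
  obtain p where q: "q = Prime p"
    using eq wcat_not_Prime by (cases q) auto
  show thesis
  proof (cases p)
    case (Letter a)
    with assms q that(1) show ?thesis by (cases a) (auto simp: star_words_def)
  next
    case (Bracket q')
    then have q': "count_list (letters q') None = 1" "wsubst q' ?L = br x \<cdot> y"
      using assms q by (auto simp: star_words_def)
    \<comment> \<open>Substituting a prime into a prime gives a prime, while
      \<open>\<lfloor>x\<rfloor>y\<close> has breadth at least two.\<close>
    have "q' \<noteq> Prime p'" for p'
    proof
      assume "q' = Prime p'"
      then have "br x \<cdot> y = wsubst_prm p' ?L" using q'(2) by simp
      then show False
        using wsubst_prm_Prime[of p' "Bracket (br u \<cdot> v)"] wcat_not_Prime[of "br x" y] by auto
    qed
    then obtain p' r where q'_eq: "q' = PCons p' r"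
      by (cases q') auto
    obtain p'' where p'': "wsubst_prm p' ?L = Prime p''"
      using wsubst_prm_Prime by blast
    with q'(2) q'_eq have r: "wsubst_prm p' ?L = br x" "wsubst r ?L = y"
      by auto
    consider (p) "count_list (letters_prm p') None = 1" "None \<notin> set (letters r)"
      | (r) "None \<notin> set (letters_prm p')" "count_list (letters r) None = 1"
      using q'(1) count_list_eq_1_append[of "letters_prm p'" "letters r" None] unfolding q'_eq by auto
    then show ?thesis
    proof cases
      case p
      have r_const: "wsubst r w = y" for w
        using wsubst_without_star[OF p(2)] r(2) by blast
      show ?thesis
      proof (cases p')
        case (Letter a)
        with p have "a = None" by (auto split: if_splits)
        with Letter r have "x = br u \<cdot> v" by simp
        then show ?thesis
          using that(4) q Bracket q'_eq Letter \<open>a = None\<close> r_const by simp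
      next
        case (Bracket s)
        then have "s \<in> star_words" "x = wsubst s ?L"
          using p r by (simp_all add: star_words_def)
        then show ?thesis
          using that(2) q \<open>p = prm.Bracket q'\<close> q'_eq Bracket r_const by simp
      qed
    next
      case r': r
      have "wsubst_prm p' w = br x" for w
        using wsubst_prm_without_star[OF r'(1), of w ?L] r(1) by simp
      then show ?thesis
        using that(3)[of r] r(2) r'(2) q Bracket q'_eq by (simp add: star_words_def)
    qed
  qed
qed

lemma no_intersection_composition:
  fixes f g :: "'x::linorder bword \<Rightarrow>\<^sub>0 'k::comm_ring_1"
  assumes "f \<in> S_mrbl lam" "g \<in> S_mrbl lam"
  shows "\<not> intersection_composition pl_le f g w h"
proof -
  have "breadth (lead pl_le s) = 1" if s: "s \<in> S_mrbl lam"
    for s :: "'x bword \<Rightarrow>\<^sub>0 'k"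
  proof -
    obtain x y where "s = mrb_rel lam (monom x) (monom y)"
      using s by (auto simp: S_mrbl_eq)
    then have "lead pl_le s = br (br x \<cdot> y)"
      using lead_psubst_mrb_rel[of "letter None" lam x y] by simp
    then show ?thesis by (simp add: breadth_def)
  qed
  \<comment> \<open>No breadth lies strictly between 1 and 2.\<close>
  from this[OF assms(1)] this[OF assms(2)] show ?thesis
    by (auto simp: intersection_composition_def)
qed

theorem groebner_shirshov_basis_S_mrbl:
  "groebner_shirshov_basis pl_le (S_mrbl lam :: ('x::linorder bword \<Rightarrow>\<^sub>0 'k::comm_ring_1) set)"
  unfolding groebner_shirshov_basis_def
proof (intro conjI ballI allI impI)
  fix s :: "'x bword \<Rightarrow>\<^sub>0 'k"
  assume "s \<in> S_mrbl lam"
  then obtain x y where s: "s = mrb_rel lam (monom x) (monom y)"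
    by (auto simp: S_mrbl_eq)
  show "monic pl_le s"
    using lead_psubst_mrb_rel[of "letter None" lam x y] lookup_psubst_mrb_rel[of "letter None" lam x y]
    unfolding s monic_def by auto
next
  fix f g h :: "'x bword \<Rightarrow>\<^sub>0 'k" and w
  assume f: "f \<in> S_mrbl lam" and g: "g \<in> S_mrbl lam"
    and "intersection_composition pl_le f g w h \<or> including_composition pl_le f g w h"
  then have incl: "including_composition pl_le f g w h"
    using no_intersection_composition by blast
  obtain x y where f_eq: "f = mrb_rel lam (monom x) (monom y)"
    using f by (auto simp: S_mrbl_eq)
  obtain u v where g_eq: "g = mrb_rel lam (monom u) (monom v)"
    using g by (auto simp: S_mrbl_eq)
  have "lead pl_le f = br (br x \<cdot> y)" "lead pl_le g = br (br u \<cdot> v)"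
    using lead_psubst_mrb_rel[of "letter None" lam] unfolding f_eq g_eq by simp_all
  with incl obtain q where q: "q \<in> star_words" "w = br (br x \<cdot> y)"
      "wsubst q (br (br u \<cdot> v)) = br (br x \<cdot> y)" and h: "h = f - psubst q g"
    unfolding including_composition_def by metis
  from q(1,3) show "trivial_mod pl_le (S_mrbl lam) w h"
  proof (cases rule: including_cases)
    case whole
    then show ?thesis by (simp add: h f_eq g_eq trivial_mod_zero)
  next
    case (left r)
    show ?thesis
      using trivial_including_composition_left[OF left(1,2)] psubst_cong[OF left(3), of g]
      unfolding h f_eq g_eq q(2) by simp
  next
    case (right r)
    show ?thesis
      using trivial_including_composition_right[OF right(1,2)] psubst_cong[OF right(3), of g]
      unfolding h f_eq g_eq q(2) by simp
  next
    case overlap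
    show ?thesis
      using trivial_including_composition_overlap[of lam u v y] psubst_cong[OF overlap(2), of g]
      unfolding h f_eq g_eq q(2) overlap(1) by simp
  qed
qed

section \<open>Operated ideals and quotients of the word algebra\<close>

lemma word_algebra_simps [simp]:
  "carrier word_algebra = UNIV" "mult word_algebra = pmult" "zero word_algebra = 0"
  "add word_algebra = (+)" "smult word_algebra = pscale" "oper word_algebra = lin_ext br"
  by (simp_all add: word_algebra_def)

section \<open>Cosets of an operated ideal and the quotient operations\<close>

locale word_ideal =
  fixes I :: "('x bword \<Rightarrow>\<^sub>0 'k::comm_ring_1) set"
  assumes operated_ideal: "operated_ideal word_algebra I"
begin

lemma zero_mem: "0 \<in> I"
  and add_mem: "s \<in> I \<Longrightarrow> t \<in> I \<Longrightarrow> s + t \<in> I"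
  and pscale_mem: "s \<in> I \<Longrightarrow> pscale c s \<in> I"
  and pmult_left_mem: "s \<in> I \<Longrightarrow> pmult r s \<in> I"
  and pmult_right_mem: "s \<in> I \<Longrightarrow> pmult s r \<in> I"
  and lin_ext_br_mem: "s \<in> I \<Longrightarrow> lin_ext br s \<in> I"
  using operated_ideal by (simp_all add: operated_ideal_def)

lemma minus_mem: "s \<in> I \<Longrightarrow> - s \<in> I"
  using pscale_mem[of s "- 1"] by (simp add: pscale_minus_one)

lemma diff_mem: "s \<in> I \<Longrightarrow> t \<in> I \<Longrightarrow> s - t \<in> I"
  using add_mem[of s "- t"] minus_mem by simp

lemmas mem_intros = zero_mem add_mem pscale_mem pmult_left_mem pmult_right_mem lin_ext_br_mem
  minus_mem diff_mem

lemma plinear_mem: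
  assumes F: "plinear F" and mem: "\<And>w. w \<in> keys s \<Longrightarrow> F (monom w) \<in> I"
  shows "F s \<in> I"
proof -
  have "F s = (\<Sum>w\<in>keys s. pscale (lookup s w) (F (monom w)))"
    using plinear_sum[OF F, of "\<lambda>w. pscale (lookup s w) (monom w)" "keys s"]
    unfolding sum_monoms by (simp only: plinear_pscale[OF F])
  moreover have "(\<Sum>w\<in>A. pscale (lookup s w) (F (monom w))) \<in> I" if "A \<subseteq> keys s" for A
    using that by (induction A rule: infinite_finite_induct) (auto intro: mem_intros mem)
  ultimately show ?thesis by simp
qed

definition coset :: "('x bword \<Rightarrow>\<^sub>0 'k) \<Rightarrow> ('x bword \<Rightarrow>\<^sub>0 'k) set" where
  "coset s = I +>\<^bsub>word_algebra\<^esub> s"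

lemma mem_coset_iff: "t \<in> coset s \<longleftrightarrow> t - s \<in> I"
  unfolding coset_def a_r_coset_def' by (force simp: algebra_simps)

lemma coset_eq_iff: "coset s = coset t \<longleftrightarrow> s - t \<in> I"
proof
  assume "coset s = coset t"
  then have "s \<in> coset t" by (auto simp: mem_coset_iff zero_mem)
  then show "s - t \<in> I" by (simp add: mem_coset_iff)
next
  assume st: "s - t \<in> I"
  have "r - s \<in> I \<longleftrightarrow> r - t \<in> I" for r
    using add_mem[OF _ st, of "r - s"] diff_mem[OF _ st, of "r - t"] by auto
  then show "coset s = coset t" by (auto simp: mem_coset_iff)
qed

lemma self_mem_coset: "s \<in> coset s"
  by (simp add: mem_coset_iff zero_mem)

lemma ideal_eq_coset_zero: "I = coset 0"
  by (auto simp: mem_coset_iff)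

abbreviation "Q \<equiv> quotient_algebra word_algebra I"

lemma carrier_Q: "carrier Q = range coset"
  by (auto simp: quotient_algebra_def A_RCOSETS_def' coset_def)

lemma zero_Q: "\<zero>\<^bsub>Q\<^esub> = coset 0"
  using ideal_eq_coset_zero by (simp add: quotient_algebra_def)

lemma add_Q: "coset s \<oplus>\<^bsub>Q\<^esub> coset t = coset (s + t)"
proof -
  have "coset s \<oplus>\<^bsub>Q\<^esub> coset t = (\<Union>a\<in>coset s. \<Union>b\<in>coset t. {a + b})"
    by (simp add: quotient_algebra_def set_add_def')
  also have "\<dots> = coset (s + t)"
  proof (rule equalityI; rule subsetI)
    fix r assume "r \<in> (\<Union>a\<in>coset s. \<Union>b\<in>coset t. {a + b})"
    then obtain a b where "a - s \<in> I" "b - t \<in> I" "r = a + b"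
      by (auto simp: mem_coset_iff)
    then show "r \<in> coset (s + t)"
      using add_mem[of "a - s" "b - t"] by (simp add: mem_coset_iff algebra_simps)
  next
    fix r assume "r \<in> coset (s + t)"
    then have "r - t \<in> coset s"
      by (simp add: mem_coset_iff algebra_simps)
    then show "r \<in> (\<Union>a\<in>coset s. \<Union>b\<in>coset t. {a + b})"
      by (intro UN_I[of "r - t"] UN_I[of t]) (simp_all add: self_mem_coset)
  qed
  finally show ?thesis .
qed

text \<open>The multiplication, scaling and operator of the quotient are unions over
  representatives; since cosets are nonempty, such a union collapses once its members agree.\<close>

lemma UN_coset_const: "(\<And>a. a \<in> coset s \<Longrightarrow> f a = K) \<Longrightarrow> (\<Union>a\<in>coset s. f a) = K"
  using self_mem_coset[of s] by simp blast

lemma mult_Q: "coset s \<otimes>\<^bsub>Q\<^esub> coset t = coset (pmult s t)"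
proof -
  have "coset (pmult a b) = coset (pmult s t)" if "a \<in> coset s" "b \<in> coset t" for a b
  proof -
    have "pmult (a - s) b + pmult s (b - t) \<in> I"
      using that unfolding mem_coset_iff by (intro add_mem pmult_right_mem pmult_left_mem)
    then show ?thesis
      by (simp add: coset_eq_iff pmult_simps)
  qed
  then have "(\<Union>a\<in>coset s. \<Union>b\<in>coset t. coset (pmult a b)) = coset (pmult s t)"
    by (intro UN_coset_const)
  then show ?thesis
    by (simp add: quotient_algebra_def rcoset_mult_def coset_def)
qed

lemma smult_Q: "c \<odot>\<^bsub>Q\<^esub> coset s = coset (pscale c s)"
proof -
  have "(\<Union>a\<in>coset s. coset (pscale c a)) = coset (pscale c s)"
  proof (rule UN_coset_const)
    fix a assume "a \<in> coset s"
    then show "coset (pscale c a) = coset (pscale c s)"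
      using pscale_mem[of "a - s" c] by (simp add: coset_eq_iff mem_coset_iff pscale_diff_right)
  qed
  then show ?thesis
    by (simp add: quotient_algebra_def coset_def)
qed

lemma oper_Q: "oper Q (coset s) = coset (lin_ext br s)"
proof -
  have "(\<Union>a\<in>coset s. coset (lin_ext br a)) = coset (lin_ext br s)"
  proof (rule UN_coset_const)
    fix a assume "a \<in> coset s"
    then show "coset (lin_ext br a) = coset (lin_ext br s)"
      using lin_ext_br_mem[of "a - s"] by (simp add: coset_eq_iff mem_coset_iff lin_ext_simps)
  qed
  then show ?thesis
    by (simp add: quotient_algebra_def coset_def)
qed

lemmas Q_simps = carrier_Q zero_Q add_Q mult_Q smult_Q oper_Q

lemma abelian_group_Q: "abelian_group Q"
proof (rule abelian_groupI)
  fix x assume "x \<in> carrier Q"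
  then obtain s where "x = coset s" by (auto simp: Q_simps)
  then show "\<exists>y\<in>carrier Q. y \<oplus>\<^bsub>Q\<^esub> x = \<zero>\<^bsub>Q\<^esub>"
    by (intro bexI[of _ "coset (- s)"]) (auto simp: Q_simps)
qed (auto simp: Q_simps ac_simps)

lemma modified_rota_baxter_algebra_Q:
  assumes "S_mrbl lam \<subseteq> I"
  shows "modified_rota_baxter_algebra lam Q"
proof -
  \<comment> \<open>The generators are relations between words only; bilinearity gives them for all
    elements.\<close>
  have "mrb_rel lam a b \<in> I" for a b
  proof (rule plinear_mem[where F = "\<lambda>a. mrb_rel lam a b"])
    fix u
    show "mrb_rel lam (monom u) b \<in> I"
    proof (rule plinear_mem[where F = "mrb_rel lam (monom u)"])
      show "mrb_rel lam (monom u) (monom v) \<in> I" for v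
        using assms by (auto simp: S_mrbl_eq)
    qed (simp add: plinear_def mrb_rel_simps)
  qed (simp add: plinear_def mrb_rel_simps)
  then have "coset (pmult (lin_ext br a) (lin_ext br b)) =
      coset (lin_ext br (pmult (lin_ext br a) b + pmult a (lin_ext br b)) + pscale lam (pmult a b))" for a b
    unfolding coset_eq_iff using minus_mem[of "mrb_rel lam a b"]
    by (simp add: mrb_rel_def lin_ext_simps algebra_simps)
  then show ?thesis
    by (intro modified_rota_baxter_algebra.intro nonunitary_algebra.intro
        nonunitary_algebra_axioms.intro modified_rota_baxter_algebra_axioms.intro abelian_group_Q)
      (auto simp: Q_simps pmult_simps lin_ext_simps pmult_assoc pscale_add_left pscale_add_right)
qed

end

lemma operated_ideal_gen:
  "word_ideal (operated_ideal_gen word_algebra S)" "S \<subseteq> operated_ideal_gen word_algebra S"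
  by (auto simp: word_ideal_def operated_ideal_gen_def operated_ideal_def)

lemma operated_ideal_gen_least:
  "operated_ideal A I \<Longrightarrow> S \<subseteq> I \<Longrightarrow> operated_ideal_gen A S \<subseteq> I"
  by (auto simp: operated_ideal_gen_def)

section \<open>The ideal of the relations as the kernel of the normal form map\<close>

context
  fixes lam :: "'k::comm_ring_1"
begin

interpretation mrb: word_ideal "mrb_ideal lam :: ('x bword \<Rightarrow>\<^sub>0 'k) set"
  unfolding mrb_ideal_def by (rule operated_ideal_gen)

lemma S_mrbl_subset: "S_mrbl lam \<subseteq> mrb_ideal lam"
  unfolding mrb_ideal_def by (rule operated_ideal_gen)

text \<open>The kernel of \<open>nf\<close> is an operated ideal, as \<open>nf\<close> turns the
  bracket into \<open>rb_op\<close>, and it contains the generators.\<close>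

lemma nf_mrb_ideal:
  assumes "s \<in> mrb_ideal lam"
  shows "nf lam s = 0"
proof -
  have "operated_ideal word_algebra {s. nf lam s = 0}"
    by (simp add: operated_ideal_def nf_simps nf_pmult pmult_simps nf_lin_ext_br rb_op_simps)
  then have "mrb_ideal lam \<subseteq> {s. nf lam s = 0}"
    unfolding mrb_ideal_def by (rule operated_ideal_gen_least) (auto simp: nf_S_mrbl)
  with assms show ?thesis by blast
qed

lemma br_minus_rb_op_mem_if:
  assumes "\<And>t. t \<in> keys s \<Longrightarrow> lin_ext br (F (monom t)) - rb_op lam (F (monom t)) \<in> mrb_ideal lam"
    and F: "plinear F"
  shows "lin_ext br (F s) - rb_op lam (F s) \<in> (mrb_ideal lam :: ('x bword \<Rightarrow>\<^sub>0 'k) set)"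
  by (rule mrb.plinear_mem[where F = "\<lambda>s. lin_ext br (F s) - rb_op lam (F s)"])
    (intro plinear_subtract plinear_comp[OF plinear_lin_ext F] plinear_comp[OF plinear_rb_op F], fact assms)

text \<open>Modulo the ideal, the relation for \<open>x\<close> and \<open>z\<close> is the
  recursion defining \<open>P(\<lfloor>x\<rfloor>z)\<close>, once \<open>\<lfloor>z\<rfloor>\<close>
  is replaced by \<open>P(z)\<close> and the outer bracket of
  \<open>\<lfloor>x P(z)\<rfloor>\<close> by \<open>P\<close>.\<close>

lemma br_minus_rb_word_mem: "monom (br w) - rb_word lam w \<in> mrb_ideal lam"
proof (induction lam\<equiv>lam w rule: rb_word.induct)
  case (3 x z)
  let ?P = "rb_op lam" and ?B = "lin_ext br" and ?x = "monom x" and ?z = "monom z"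
    and ?bx = "monom (br x)"
  have rel: "mrb_rel lam ?x ?z \<in> mrb_ideal lam"
    using S_mrbl_subset by (auto simp: S_mrbl_eq)
  have z: "?B ?z - ?P ?z \<in> mrb_ideal lam"
    using "3" by simp
  have xz: "?B (pmult ?x (?P ?z)) - ?P (pmult ?x (?P ?z)) \<in> mrb_ideal lam"
    by (rule br_minus_rb_op_mem_if[OF _ plinear_pmult_right]) (use "3" in simp)
  have "mrb_rel lam ?x ?z + pmult ?bx (?B ?z - ?P ?z) - ?B (pmult ?x (?B ?z - ?P ?z))
      - (?B (pmult ?x (?P ?z)) - ?P (pmult ?x (?P ?z))) \<in> mrb_ideal lam"
    by (intro mrb.mem_intros rel z xz)
  then show ?case
    unfolding rb_word_Bracket mrb_rel_def pmult_simps lin_ext_simps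
    by (simp add: algebra_simps del: rb_op_monom)
qed (simp_all add: mrb.zero_mem)

lemma br_minus_rb_op_mem: "lin_ext br s - rb_op lam s \<in> mrb_ideal lam"
  by (rule br_minus_rb_op_mem_if[where F = "\<lambda>s. s"]) (simp_all add: br_minus_rb_word_mem plinear_id)

text \<open>Working inside out, the content of a bracket is first replaced by its normal form, then
  the bracket by \<open>P\<close>; each change lies in the ideal.\<close>

lemma word_minus_nf_word_mem: "monom w - nf_word lam (w :: 'x bword) \<in> mrb_ideal lam"
  and prm_minus_nf_prm_mem: "monom (Prime p) - nf_prm lam (p :: 'x prm) \<in> mrb_ideal lam"
proof (induction w and p rule: bword.induct prm.induct)
  case (PCons p w)
  let ?d = "pmult (monom (Prime p) - nf_prm lam p) (monom w)
      + pmult (nf_prm lam p) (monom w - nf_word lam w)"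
  have "?d \<in> mrb_ideal lam"
    by (intro mrb.mem_intros PCons.IH)
  moreover have "?d = monom (PCons p w) - nf_word lam (PCons p w)"
    by (simp add: pmult_simps)
  ultimately show ?case by simp
next
  case (Bracket w)
  let ?d = "lin_ext br (monom w - nf_word lam w)
      + (lin_ext br (nf_word lam w) - rb_op lam (nf_word lam w))"
  have "?d \<in> mrb_ideal lam"
    by (intro mrb.mem_intros Bracket.IH br_minus_rb_op_mem)
  then show ?case by (simp add: lin_ext_simps)
qed (simp_all add: mrb.zero_mem)

lemma minus_nf_mem: "s - nf lam s \<in> mrb_ideal lam"
  by (rule mrb.plinear_mem[where F = "\<lambda>s. s - nf lam s"])
    (simp_all add: plinear_subtract plinear_id plinear_nf word_minus_nf_word_mem)

section \<open>Irreducible words as a basis of the quotient\<close>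

lemma finsum_coset:
  "finite F \<Longrightarrow> (\<Oplus>\<^bsub>mrb.Q\<^esub>w\<in>F. c w \<odot>\<^bsub>mrb.Q\<^esub> mrb.coset (f w)) = mrb.coset (\<Sum>w\<in>F. pscale (c w) (f w))"
proof (induction F rule: finite_induct)
  case empty
  interpret abelian_group mrb.Q by (rule mrb.abelian_group_Q)
  show ?case by (simp add: mrb.zero_Q)
next
  case (insert w F)
  interpret abelian_group mrb.Q by (rule mrb.abelian_group_Q)
  show ?case
    using insert by (subst finsum_insert) (auto simp: mrb.Q_simps)
qed

text \<open>A combination of irreducible words in the ideal is both fixed and killed by
  \<open>nf\<close>, hence zero. Spanning holds because each class contains the normal form of its
  representatives.\<close>

theorem basis_family_mrb_quotient:
  "basis_family (mrb_quotient lam :: ('k, ('x bword \<Rightarrow>\<^sub>0 'k) set) operated_algebra)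
     (mrb_class lam) Irr_mrbl"
proof -
  have class_eq: "mrb_class lam w = mrb.coset (monom w)" for w :: "'x bword"
    by (simp add: mrb_class_def mrb.coset_def)
  have indep: "c w = 0" if F: "finite F" "F \<subseteq> Irr_mrbl" "w \<in> F"
    and "(\<Oplus>\<^bsub>mrb.Q\<^esub>w\<in>F. c w \<odot>\<^bsub>mrb.Q\<^esub> mrb.coset (monom w)) = \<zero>\<^bsub>mrb.Q\<^esub>"
    for F c and w :: "'x bword"
  proof -
    let ?s = "\<Sum>w\<in>F. pscale (c w) (monom w) :: 'x bword \<Rightarrow>\<^sub>0 'k"
    have "?s \<in> mrb_ideal lam"
      using that by (simp add: finsum_coset mrb.zero_Q mrb.coset_eq_iff)
    moreover have lookup: "lookup ?s v = (if v \<in> F then c v else 0)" for v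
      using F(1) by (simp add: Poly_Mapping.lookup_sum lookup_single when_def sum.delta)
    then have "keys ?s \<subseteq> {w. irr w}"
      using F(2) by (auto simp: in_keys_iff Irr_mrbl_eq split: if_splits)
    ultimately have "?s = 0"
      using nf_mrb_ideal nf_of_irr by metis
    then show ?thesis using lookup[of w] F(3) by simp
  qed
  have span: "\<exists>F c. finite F \<and> F \<subseteq> Irr_mrbl
      \<and> a = (\<Oplus>\<^bsub>mrb.Q\<^esub>w\<in>F. c w \<odot>\<^bsub>mrb.Q\<^esub> mrb.coset (monom w))" if a: "a \<in> carrier mrb.Q"
    for a :: "('x bword \<Rightarrow>\<^sub>0 'k) set"
  proof -
    obtain s where "a = mrb.coset s"
      using a by (auto simp: mrb.carrier_Q)
    then have "a = mrb.coset (nf lam s)"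
      by (simp add: mrb.coset_eq_iff minus_nf_mem)
    then have "a = (\<Oplus>\<^bsub>mrb.Q\<^esub>w\<in>keys (nf lam s). lookup (nf lam s) w \<odot>\<^bsub>mrb.Q\<^esub> mrb.coset (monom w))"
      unfolding finsum_coset[OF finite_keys] sum_monoms .
    moreover have "keys (nf lam s) \<subseteq> Irr_mrbl"
      using irr_nf by (auto simp: Irr_mrbl_eq)
    ultimately show ?thesis
      by (intro exI[of _ "keys (nf lam s)"] exI[of _ "lookup (nf lam s)"]) simp
  qed
  show ?thesis
    unfolding basis_family_def class_eq mrb_quotient_def
    by (intro conjI ballI allI impI) (simp add: mrb.carrier_Q, rule indep, assumption+, rule span)
qed

end

section \<open>Evaluation of bracketed words and freeness\<close>

context nonunitary_algebra
begin

lemma scale_zero_left: "x \<in> carrier A \<Longrightarrow> 0 \<odot> x = \<zero>"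
  using scale_add_left[of x 0 0] scale_closed[of x 0] by simp

lemma scale_zero_right: "c \<odot> \<zero> = \<zero>"
  using scale_add_right[of \<zero> \<zero> c] scale_closed[of \<zero> c] by simp

lemma mult_zero_left: "x \<in> carrier A \<Longrightarrow> \<zero> \<otimes> x = \<zero>"
  using mult_add_left[of \<zero> \<zero> x] mult_closed[of \<zero> x] by simp

lemma mult_zero_right: "x \<in> carrier A \<Longrightarrow> x \<otimes> \<zero> = \<zero>"
  using mult_add_right[of \<zero> \<zero> x] mult_closed[of x \<zero>] by simp

lemma scale_finsum:
  "f \<in> F \<rightarrow> carrier A \<Longrightarrow> c \<odot> (\<Oplus>i\<in>F. f i) = (\<Oplus>i\<in>F. c \<odot> f i)"
proof (induction F rule: infinite_finite_induct)
  case (insert i F)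
  then have "f i \<in> carrier A" "f \<in> F \<rightarrow> carrier A" by auto
  then show ?case
    using insert by (simp add: finsum_insert scale_closed scale_add_right Pi_def)
qed (simp_all add: scale_zero_right finsum_infinite)

end

section \<open>Evaluation of bracketed words at given values of the letters\<close>

primrec eval_word :: "('k, 'a) operated_algebra \<Rightarrow> ('x \<Rightarrow> 'a) \<Rightarrow> 'x bword \<Rightarrow> 'a"
  and eval_prm :: "('k, 'a) operated_algebra \<Rightarrow> ('x \<Rightarrow> 'a) \<Rightarrow> 'x prm \<Rightarrow> 'a" where
  "eval_word A \<phi> (Prime p) = eval_prm A \<phi> p"
| "eval_word A \<phi> (PCons p w) = eval_prm A \<phi> p \<otimes>\<^bsub>A\<^esub> eval_word A \<phi> w"
| "eval_prm A \<phi> (Letter x) = \<phi> x"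
| "eval_prm A \<phi> (Bracket w) = oper A (eval_word A \<phi> w)"

definition eval_poly :: "('k::comm_ring_1, 'a) operated_algebra \<Rightarrow> ('x \<Rightarrow> 'a) \<Rightarrow> ('x bword \<Rightarrow>\<^sub>0 'k) \<Rightarrow> 'a" where
  "eval_poly A \<phi> s = (\<Oplus>\<^bsub>A\<^esub>w\<in>keys s. lookup s w \<odot>\<^bsub>A\<^esub> eval_word A \<phi> w)"

locale modified_rota_baxter_eval = modified_rota_baxter_algebra lam A
  for lam :: "'k::comm_ring_1" and A :: "('k, 'a) operated_algebra" (structure) +
  fixes \<phi> :: "'x \<Rightarrow> 'a"
  assumes letters_closed: "\<phi> x \<in> carrier A"
begin

abbreviation "ev \<equiv> eval_poly A \<phi>"

lemma eval_word_closed [simp]: "eval_word A \<phi> (w :: 'x bword) \<in> carrier A"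
  and eval_prm_closed [simp]: "eval_prm A \<phi> (p :: 'x prm) \<in> carrier A"
  by (induction w and p rule: bword.induct prm.induct) (simp_all add: mult_closed oper_closed letters_closed)

lemma eval_word_wcat: "eval_word A \<phi> (u \<cdot> v) = eval_word A \<phi> u \<otimes> eval_word A \<phi> v"
  by (induction u rule: bword.induct[where ?P2.0 = "\<lambda>_. True"]) (simp_all add: mult_assoc)

lemma eval_poly_superset:
  assumes "finite F" "keys s \<subseteq> F"
  shows "ev s = (\<Oplus>w\<in>F. lookup s w \<odot> eval_word A \<phi> w)"
  unfolding eval_poly_def
  by (rule add.finprod_mono_neutral_cong_left)
    (use assms in \<open>auto simp: in_keys_iff scale_zero_left scale_closed\<close>)

lemma eval_poly_closed [simp]: "ev s \<in> carrier A"
  unfolding eval_poly_def by (rule finsum_closed) (simp add: scale_closed)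

lemma eval_poly_monom: "ev (monom w) = eval_word A \<phi> w"
proof -
  have "ev (monom w) = (\<Oplus>v\<in>{w}. lookup (monom w) v \<odot> eval_word A \<phi> v)"
    by (rule eval_poly_superset) auto
  then show ?thesis
    by (simp add: scale_one scale_closed finsum_insert)
qed

lemma eval_poly_add: "ev (s + t) = ev s \<oplus> ev t"
proof -
  let ?F = "keys s \<union> keys t \<union> keys (s + t)"
  have "ev s = (\<Oplus>w\<in>?F. lookup s w \<odot> eval_word A \<phi> w)"
    and "ev t = (\<Oplus>w\<in>?F. lookup t w \<odot> eval_word A \<phi> w)"
    and "ev (s + t) = (\<Oplus>w\<in>?F. lookup (s + t) w \<odot> eval_word A \<phi> w)"
    by (intro eval_poly_superset; auto)+
  then show ?thesis
    by (simp add: lookup_add scale_add_left scale_closed finsum_addf Pi_def)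
qed

lemma eval_poly_pscale: "ev (pscale c s) = c \<odot> ev s"
proof -
  have "ev (pscale c s) = (\<Oplus>w\<in>keys s. lookup (pscale c s) w \<odot> eval_word A \<phi> w)"
    by (rule eval_poly_superset) (simp_all add: keys_pscale)
  also have "\<dots> = (\<Oplus>w\<in>keys s. c \<odot> (lookup s w \<odot> eval_word A \<phi> w))"
    by (simp add: scale_scale)
  finally show ?thesis
    by (simp add: eval_poly_def scale_finsum scale_closed Pi_def)
qed

lemma eval_poly_zero: "ev 0 = \<zero>"
  by (simp add: eval_poly_def)

lemma eval_poly_pmult: "ev (pmult s t) = ev s \<otimes> ev t"
proof (induction s rule: poly_mapping_linear_induct)
  case (add s c u)
  have "ev (pmult (monom u) t) = ev (monom u) \<otimes> ev t"
  proof (induction t rule: poly_mapping_linear_induct)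
    case (add t d v)
    then show ?case
      by (simp add: pmult_simps eval_poly_add eval_poly_pscale eval_poly_monom eval_word_wcat
          mult_add_right scale_mult_right scale_closed del: pscale_single)
  qed (simp add: pmult_simps eval_poly_zero mult_zero_right)
  with add show ?case
    by (simp add: pmult_simps eval_poly_add eval_poly_pscale mult_add_left scale_mult_left
        scale_closed del: pscale_single)
qed (simp add: pmult_simps eval_poly_zero mult_zero_left)

lemma oper_zero: "oper A \<zero> = \<zero>"
  using oper_scale[of \<zero> 0] oper_closed[of \<zero>] by (simp add: scale_zero_left scale_zero_right)

lemma eval_poly_br: "ev (lin_ext br s) = oper A (ev s)"
proof (induction s rule: poly_mapping_linear_induct)
  case (add s c u)
  then show ?case
    by (simp add: lin_ext_simps eval_poly_add eval_poly_pscale eval_poly_monom oper_add oper_scale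
        scale_closed del: pscale_single)
qed (simp add: lin_ext_simps eval_poly_zero oper_zero)

lemma eval_poly_mrb_rel: "ev (mrb_rel lam a b) = \<zero>"
proof -
  let ?m = "pmult (lin_ext br a) (lin_ext br b)"
  \<comment> \<open>The negative term is moved across so that additivity of the evaluation suffices;
    it is cancelled in the group at the end.\<close>
  have "mrb_rel lam a b + ?m
      = lin_ext br (pmult (lin_ext br a) b + pmult a (lin_ext br b)) + pscale lam (pmult a b)"
    by (simp add: mrb_rel_def lin_ext_simps)
  then have "ev (mrb_rel lam a b) \<oplus> ev ?m
      = ev (lin_ext br (pmult (lin_ext br a) b + pmult a (lin_ext br b)) + pscale lam (pmult a b))"
    by (metis eval_poly_add)
  also have "\<dots> = ev ?m"
    by (simp add: eval_poly_add eval_poly_br eval_poly_pmult eval_poly_pscale modified_rota_baxter)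
  finally show ?thesis
    by simp
qed

lemma operated_ideal_eval_kernel: "operated_ideal word_algebra {s. ev s = \<zero>}"
  by (simp add: operated_ideal_def eval_poly_zero eval_poly_add eval_poly_pscale eval_poly_pmult
      eval_poly_br scale_zero_right mult_zero_left mult_zero_right oper_zero)

lemma eval_poly_mrb_ideal: "s \<in> mrb_ideal lam \<Longrightarrow> ev s = \<zero>"
  using operated_ideal_gen_least[OF operated_ideal_eval_kernel, of "S_mrbl lam"] eval_poly_mrb_rel
  by (auto simp: mrb_ideal_def S_mrbl_eq)

end

text \<open>Evaluation kills the ideal, so it factors through the quotient. It is the only such
  homomorphism, since the letter classes generate the quotient under its operations.\<close>

theorem free_mrb_quotient:
  fixes lam :: "'k::comm_ring_1"
  shows "free_modified_rota_baxter_algebra TYPE('b) lam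
    (mrb_quotient lam :: ('k, ('x bword \<Rightarrow>\<^sub>0 'k) set) operated_algebra) (\<lambda>x. mrb_class lam (letter x))"
proof -
  interpret mrb: word_ideal "mrb_ideal lam :: ('x bword \<Rightarrow>\<^sub>0 'k) set"
    unfolding mrb_ideal_def by (rule operated_ideal_gen)
  have class_eq: "mrb_class lam w = mrb.coset (monom w)" for w :: "'x bword"
    by (simp add: mrb_class_def mrb.coset_def)
  have ex1: "\<exists>!f. f \<in> operated_hom mrb.Q B \<and> f \<in> extensional (carrier mrb.Q)
      \<and> (\<forall>x. f (mrb.coset (monom (letter x))) = \<phi> x)"
    if B: "modified_rota_baxter_algebra lam B" "\<forall>x. \<phi> x \<in> carrier B"
    for B :: "('k, 'b) operated_algebra" and \<phi> :: "'x \<Rightarrow> 'b"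
  proof -
    interpret modified_rota_baxter_algebra lam B by (rule B(1))
    interpret modified_rota_baxter_eval lam B \<phi>
      by unfold_locales (use B(2) in simp)
    have ev_cong: "ev s = ev t" if "mrb.coset s = mrb.coset t" for s t
    proof -
      have "ev (s - t) = \<zero>\<^bsub>B\<^esub>"
        using that by (intro eval_poly_mrb_ideal) (simp add: mrb.coset_eq_iff)
      then show ?thesis
        using eval_poly_add[of "s - t" t] by simp
    qed
    \<comment> \<open>Any representative serves, by \<open>ev_cong\<close>; the restriction to the
      carrier makes \<open>f\<close> extensional.\<close>
    define f where "f = (\<lambda>C\<in>carrier mrb.Q. ev (SOME s. mrb.coset s = C))"
    have f_coset: "f (mrb.coset s) = ev s" for s
    proof -
      have "mrb.coset (SOME t. mrb.coset t = mrb.coset s) = mrb.coset s"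
        by (rule someI) simp
      from ev_cong[OF this] show ?thesis
        by (simp add: f_def mrb.carrier_Q)
    qed
    have f_hom: "f \<in> operated_hom mrb.Q B"
      by (auto simp: operated_hom_def mrb.Q_simps f_coset eval_poly_add eval_poly_pmult
          eval_poly_pscale eval_poly_br)
    have unique: "h (mrb.coset s) = ev s" if h: "h \<in> operated_hom mrb.Q B"
      and letter: "\<forall>x. h (mrb.coset (monom (letter x))) = \<phi> x" for h s
    proof -
      have h_add: "h (mrb.coset (s + t)) = h (mrb.coset s) \<oplus>\<^bsub>B\<^esub> h (mrb.coset t)"
        and h_mult: "h (mrb.coset (pmult s t)) = h (mrb.coset s) \<otimes>\<^bsub>B\<^esub> h (mrb.coset t)"
        and h_scale: "h (mrb.coset (pscale c s)) = c \<odot>\<^bsub>B\<^esub> h (mrb.coset s)"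
        and h_br: "h (mrb.coset (lin_ext br s)) = oper B (h (mrb.coset s))"
        and h_closed: "h (mrb.coset s) \<in> carrier B" for s t c
        using h unfolding operated_hom_def by (auto simp: mrb.carrier_Q simp flip: mrb.Q_simps(3-6))
      have h_word: "h (mrb.coset (monom w)) = eval_word B \<phi> w"
        and h_prm: "h (mrb.coset (monom (Prime p))) = eval_prm B \<phi> p" for w p
      proof (induction w and p rule: bword.induct prm.induct)
        case (PCons p w)
        then show ?case using h_mult[of "monom (Prime p)" "monom w"] by simp
      next
        case (Bracket w)
        then show ?case using h_br[of "monom w"] by simp
      qed (simp_all add: letter)
      show ?thesis
      proof (induction s rule: poly_mapping_linear_induct)
        case zero
        show ?case
          \<comment> \<open>Homomorphisms are not assumed to preserve zero; this follows from
            scaling by 0.\<close>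
          using h_scale[of 0 0] h_closed[of 0] by (simp add: scale_zero_left eval_poly_zero)
      next
        case (add s c w)
        then show ?case
          by (simp add: h_add h_scale h_word eval_poly_add eval_poly_pscale eval_poly_monom
              del: pscale_single)
      qed
    qed
    show ?thesis
    proof (rule ex1I[of _ f])
      show "f \<in> operated_hom mrb.Q B \<and> f \<in> extensional (carrier mrb.Q)
          \<and> (\<forall>x. f (mrb.coset (monom (letter x))) = \<phi> x)"
        using f_hom by (simp add: f_coset eval_poly_monom) (simp add: f_def)
    next
      fix h
      assume h: "h \<in> operated_hom mrb.Q B \<and> h \<in> extensional (carrier mrb.Q)
          \<and> (\<forall>x. h (mrb.coset (monom (letter x))) = \<phi> x)"
      show "h = f"
      proof (rule extensionalityI)
        show "h \<in> extensional (carrier mrb.Q)" "f \<in> extensional (carrier mrb.Q)"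
          using h by (simp_all add: f_def)
        fix C assume "C \<in> carrier mrb.Q"
        then show "h C = f C"
          using h unique by (auto simp: mrb.carrier_Q f_coset)
      qed
    qed
  qed
  have "modified_rota_baxter_algebra lam mrb.Q"
    by (rule mrb.modified_rota_baxter_algebra_Q[OF S_mrbl_subset])
  then show ?thesis
    unfolding free_modified_rota_baxter_algebra_def class_eq mrb_quotient_def
    using ex1 by (simp add: mrb.carrier_Q)
qed

theorem theorem4p6:
  fixes lam :: "'k::{comm_ring_1,ring_char_0}"
  shows
    "groebner_shirshov_basis pl_le (S_mrbl lam :: ('x::wellorder bword \<Rightarrow>\<^sub>0 'k) set) \<and>
     free_modified_rota_baxter_algebra TYPE('b) lam
       (mrb_quotient lam :: ('k, ('x bword \<Rightarrow>\<^sub>0 'k) set) operated_algebra)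
       (\<lambda>x. mrb_class lam (letter x)) \<and>
     basis_family (mrb_quotient lam :: ('k, ('x bword \<Rightarrow>\<^sub>0 'k) set) operated_algebra)
       (mrb_class lam) Irr_mrbl"
  by (intro conjI groebner_shirshov_basis_S_mrbl free_mrb_quotient basis_family_mrb_quotient)

end
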